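(* Let $R_3$ be a real rational function of degree three satisfying the standing assumptions listed in the context, let $\lambda\in(1,2)$, and suppose that $\mathcal P(R_3)$ is conformally equivalent, respecting the colors of boundary components, to the pair of pants $\mathcal P_s(\lambda,h_1,h_2|m_1,m_2)$ with $s\in\{1,2,3\}$. Let $p(y)$ be the conformal map from $\mathcal P(R_3)$ to $\mathcal P_s(\lambda,h_1,h_2|m_1,m_2)$, regarded as a function with values in $\hat{\mathbb C}$, and let $$u(x)=\sqrt{\frac{(y-y_1)(y-y_2)}{p'(y^+)\,p'(y^-)}}\ \frac{p(y^+)-p(y^-)}{w(y)},\qquad x\in[-1,1],\quad y:=R_3(x),\quad y^\pm:=y\pm i0,$$ be the related eigenfunction of the integral equation $$\lambda\ \mathrm{V.p.}\!\int_{-1}^{1}\frac{u(t)}{t-x}\,dt-\mathrm{V.p.}\!\int_{-1}^{1}\frac{u(t)\,dR_3(t)}{R_3(t)-R_3(x)}=\mathrm{const},\qquad x\in(-1,1).$$ Here $w^2(y)=(y^2-1)\prod_{s=1}^4(y-a_s)$; for $s=1$, $y_1=\overline{y_2}$ is the critical point of $p$; for $s=2,3$, the real numbers $y_1,y_2$ are the critical points of $p$. Then $u$ has exactly $m_1+m_2+2$ zeroes on the segment $[-1,1]$ when $s=2,3$, and exactly $m_1+m_2+3$ zeroes on $[-1,1]$ when $s=1$.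
   Context: **Standing assumptions on $R_3$.** $\hat{\mathbb R}=\mathbb R\cup\{\infty\}$, $\hat{\mathbb C}=\mathbb C\cup\{\infty\}$. $R_3$ is a real rational function of degree 3 with four distinct critical values $a_1,\dots,a_4\in\hat{\mathbb R}$, all different from $\pm1$. Over $a_s$ lie one double (critical) point $b_s$ and one ordinary point $c_s$, all in $\hat{\mathbb R}$. The $a_s$ are numbered in the natural cyclic order of $\hat{\mathbb R}$ so that every $y$ in $(a_1,a_2)$ or $(a_3,a_4)$ has one real and two complex conjugate preimages, while the other points $y\in\hat{\mathbb R}$, $y\ne a_s$, have three distinct real preimages. $R_3$ is a nondegenerate change of variable on $[-1,1]$: it maps $[-1,1]$ onto itself with $R_3'\neq0$ on $[-1,1]$. Moreover $[-1,1]\subset(b_2,b_3)$, where $(b_2,b_3)$ is the interval of $\hat{\mathbb R}$ between $b_2$ and $b_3$ containing no other critical point. Consequently $[-1,1]$, $[a_1,a_2]$, $[a_3,a_4]$ are disjoint. **The pants $\mathcal P(R_3)$.** $\mathcal P(R_3):=\mathrm{Closure}\big(\hat{\mathbb C}\setminus([-1,1]\cup[a_1,a_2]\cup[a_3,a_4])\big)$, the closure being taken in the intrinsic metric, so that each slot acquires two sides. Boundary components are colored: $[-1,1]$ red, $[a_1,a_2]$ blue, $[a_3,a_4]$ green. It is assumed that $\infty$ lies strictly inside $\mathcal P(R_3)$. **The pants $\mathcal P_s$.** These are defined for $\lambda\in(1,2)$ and integers $m_1,m_2\ge0$. Let $\varepsilon=e^{2\pi i/3}$, $\mu=\sqrt{(3-\lambda)/(2\lambda)}\in(\tfrac12,1)$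 and $C=\{p\in\mathbb C:|p-\mu^{-1}|^2=\mu^{-2}-1\}$; this circle is disjoint from the lines $\varepsilon^{\pm1}\mathbb R$. Let $\alpha\subset\hat{\mathbb C}$ be the annulus bounded by $\varepsilon\hat{\mathbb R}$ and $C$, and $\overline\alpha$ the annulus bounded by $\varepsilon^2\hat{\mathbb R}$ and $C$. Colors: $C$ red, $\varepsilon\hat{\mathbb R}$ green, $\varepsilon^2\hat{\mathbb R}$ blue. *Fashion 1* ($h=h_1+ih_2$ in the interior of $\alpha\cap\overline\alpha$). Cut one copy of $\alpha$ and one copy of $\overline\alpha$ along the same segment joining $h$ to $C$, and glue the left bank of each cut to the right bank of the other. The resulting two-sheeted surface over the sphere is $\mathcal P_1(\lambda,h_1,h_2|0,0)$. To obtain $\mathcal P_1(\lambda,h_1,h_2|m_1,m_2)$, cut the sheet $\alpha$ of this surface and $m_1$ further copies of $\alpha$ along the same segment joining $\varepsilon\hat{\mathbb R}$ to $C$ (disjoint from the first cut), and glue the left bank of the cut on every copy to the right bank of the cut on another copy cyclically, so that all copies become one piece. Do the same with the sheet $\overline\alpha$ and $m_2$ further copies of $\overline\alpha$, using a segment joining $\varepsilon^2\hat{\mathbb R}$ to $C$. *Fashion 2* ($0<h_1<h_2<\infty$). $\mathcal P_2(\lambda,h_1,h_2|0,0)$ is $\alpha$ with the segment $-\varepsilon^2[h_1,h_2]$ removed (closed by two-sided slit; the slit is blue). $\mathcal P_2(\lambda,h_1,h_2|m_1,m_2)$ is obtained by cyclically gluing in $m_1$ copies of $\alpha$ along a segment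 joining $\varepsilon\hat{\mathbb R}$ to $C$, and $m_2$ copies of $\overline\alpha$ along a segment lying in $\alpha\cap\overline\alpha$ and joining a point of the slit $-\varepsilon^2[h_1,h_2]$ to $C$ (cut each copy of $\overline\alpha$ along the same segment). Here cyclically gluing in copies of an annulus along a segment means: cut the surface $\mathcal P_2(\lambda,h_1,h_2|0,0)$ and all the copies of the annulus along this same segment, and glue the left bank of the cut on every sheet to the right bank of the cut on another sheet cyclically, so that all the sheets become one piece. *Fashion 3* ($0<h_1<h_2<\infty$). $\mathcal P_3(\lambda,h_1,h_2|0,0)$ is $\overline\alpha$ with the segment $-\varepsilon[h_1,h_2]$ removed (the slit is green). $\mathcal P_3(\lambda,h_1,h_2|m_1,m_2)$ is obtained by gluing in $m_2$ copies of $\overline\alpha$ along a segment joining $\varepsilon^2\hat{\mathbb R}$ to $C$ and $m_1$ copies of $\alpha$ along a segment in $\alpha\cap\overline\alpha$ joining a point of the slit to $C$. Boundary components of $\mathcal P_s$ inherit the colors of the circles they cover. **Critical points.** Critical points of $p$ on the boundary of $\mathcal P(R_3)$ are understood with respect to a local parameter of the double $\{w^2=(y^2-1)\prod_{s=1}^4(y-a_s)\}$ of $\mathcal P(R_3)$ (for example $\sqrt{y-a}$ at an endpoint $a$ of a slot). *)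

theory Defs
  imports
    "HOL-Analysis.Analysis"
    "HOL-Complex_Analysis.Complex_Analysis"
    "HOL-Computational_Algebra.Computational_Algebra"
begin

section \<open>The Riemann sphere\<close>

text \<open>A point of the sphere is \<open>Some z\<close> with \<open>z\<close> complex, or \<open>None\<close>, the point at infinity.\<close>

type_synonym sphere = "complex option"

definition sphere_top :: "sphere topology" where
  "sphere_top = Alexandroff_compactification euclidean"

definition real_circle :: "sphere set" where
  "real_circle = insert None ((\<lambda>t. Some (complex_of_real t)) ` UNIV)"

text \<open>Local coordinate centred at a point of the sphere, and its inverse.
  \<open>the None\<close> is never met near \<open>t = 0\<close> when the coordinate is applied to a continuous map.\<close>

definition chart :: "sphere \<Rightarrow> sphere \<Rightarrow> complex" where
  "chart w z = (case w of Some c \<Rightarrow> the z - c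
                        | None \<Rightarrow> (case z of None \<Rightarrow> 0 | Some y \<Rightarrow> inverse y))"

definition chart_inv :: "sphere \<Rightarrow> complex \<Rightarrow> sphere" where
  "chart_inv w t = (case w of Some c \<Rightarrow> Some (c + t)
                            | None \<Rightarrow> (if t = 0 then None else Some (inverse t)))"


section \<open>Real rational functions of degree three\<close>

text \<open>A real rational function is a pair of coprime real polynomials.\<close>

definition rat_map :: "real poly \<Rightarrow> real poly \<Rightarrow> sphere \<Rightarrow> sphere" where
  "rat_map P Q z = (case z of
      Some c \<Rightarrow> (if poly (map_poly complex_of_real Q) c = 0 then None
                 else Some (poly (map_poly complex_of_real P) c / poly (map_poly complex_of_real Q) c))
    | None \<Rightarrow> (if degree P > degree Q then None
               else Some (complex_of_real (coeff P (degree Q) / lead_coeff Q))))"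

definition rat_degree :: "real poly \<Rightarrow> real poly \<Rightarrow> nat" where
  "rat_degree P Q = max (degree P) (degree Q)"

text \<open>Multiplicity of \<open>z\<close> as a preimage of the finite real value \<open>v\<close>: the order of vanishing
  of the numerator \<open>P - v Q\<close>, read at infinity as a form of degree \<open>rat_degree P Q\<close>.\<close>

definition fibre_mult :: "real poly \<Rightarrow> real poly \<Rightarrow> real \<Rightarrow> sphere \<Rightarrow> nat" where
  "fibre_mult P Q v z = (case z of
      Some c \<Rightarrow> order c (map_poly complex_of_real (P - smult v Q))
    | None \<Rightarrow> rat_degree P Q - degree (P - smult v Q))"

text \<open>The values \<open>a s\<close> are finite, and only two rotations of the cyclic order of \<open>a 1, \<dots>, a 4\<close>
  occur, because infinity is assumed to lie strictly inside the pants, that is, outside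
  the slots \<open>[a 1, a 2]\<close> and \<open>[a 3, a 4]\<close>.
  The interval \<open>(b 2, b 3)\<close> is that arc of the real circle cut at \<open>b 2, b 3\<close>
  which contains no other critical point. The disjointness of the slots is a consequence
  of the other clauses.\<close>

definition standing_assumptions ::
  "real poly \<Rightarrow> real poly \<Rightarrow> (nat \<Rightarrow> real) \<Rightarrow> (nat \<Rightarrow> sphere) \<Rightarrow> (nat \<Rightarrow> sphere) \<Rightarrow> bool" where
  "standing_assumptions P Q a b c \<longleftrightarrow>
     coprime P Q \<and> rat_degree P Q = 3 \<and>
     (a 1 < a 2 \<and> a 2 < a 3 \<and> a 3 < a 4 \<or> a 3 < a 4 \<and> a 4 < a 1 \<and> a 1 < a 2) \<and>
     (\<forall>s\<in>{1..4}. a s \<noteq> 1 \<and> a s \<noteq> -1 \<and> b s \<in> real_circle \<and> c s \<in> real_circle \<and>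
        fibre_mult P Q (a s) (b s) = 2 \<and> fibre_mult P Q (a s) (c s) = 1) \<and>
     (\<forall>y \<in> {a 1<..<a 2} \<union> {a 3<..<a 4}. \<exists>x\<in>real_circle. \<exists>z. Im z \<noteq> 0 \<and>
        {q. rat_map P Q q = Some (complex_of_real y)} = {x, Some z, Some (cnj z)}) \<and>
     (\<forall>v \<in> real_circle - (\<lambda>t. Some (complex_of_real t)) ` ({a 1..a 2} \<union> {a 3..a 4}).
        card {q \<in> real_circle. rat_map P Q q = v} = 3) \<and>
     (\<forall>x\<in>{-1..1}. poly Q x \<noteq> 0) \<and>
     (\<lambda>x. poly P x / poly Q x) ` {-1..1} = {-1..1} \<and>
     (\<forall>x\<in>{-1..1}. deriv (\<lambda>x. poly P x / poly Q x) x \<noteq> 0) \<and>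
     (\<exists>J \<in> connected_components_of (subtopology sphere_top (real_circle - {b 2, b 3})).
        b 1 \<notin> J \<and> b 4 \<notin> J \<and> (\<lambda>t. Some (complex_of_real t)) ` {-1..1} \<subseteq> J) \<and>
     {-1..1} \<inter> {a 1..a 2} = {} \<and> {-1..1} \<inter> {a 3..a 4} = {} \<and> {a 1..a 2} \<inter> {a 3..a 4} = {}"


section \<open>Surfaces cut and glued from sheets over the sphere\<close>

text \<open>\<open>side A B True\<close> is the open half-plane to the left of the directed line \<open>A B\<close>,
  \<open>side A B False\<close> the one to its right.\<close>

definition side :: "complex \<Rightarrow> complex \<Rightarrow> bool \<Rightarrow> complex \<Rightarrow> bool" where
  "side A B d z \<longleftrightarrow> (if d then Im ((z - A) / (B - A)) > 0 else Im ((z - A) / (B - A)) < 0)"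

text \<open>Gluing data for sheets labelled by \<open>'k\<close>.
  \<^item> \<open>region k\<close>: the closed region of the sphere from which sheet \<open>k\<close> is made
    (empty for a label that is not used).
  \<^item> \<open>slits k\<close>: segments removed from sheet \<open>k\<close> and replaced by their two banks.
  \<^item> \<open>seams k\<close>: an element \<open>(A, B, l)\<close> says that sheet \<open>k\<close> is cut along \<open>[A, B]\<close> and that the left
    bank of this cut is glued to the right bank of the same cut of sheet \<open>l\<close>.
    Taking \<open>l = k\<close> amounts to not cutting.
  \<^item> \<open>pins k z\<close>: the other sheets that meet sheet \<open>k\<close> at the branch point over \<open>z\<close>. This common point
    is stored on sheet \<open>k\<close> only and is to be deleted from the regions of the sheets \<open>pins k z\<close>.\<close>

record 'k sewing =
  region :: "'k \<Rightarrow> sphere set"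
  slits :: "'k \<Rightarrow> (complex \<times> complex) set"
  seams :: "'k \<Rightarrow> (complex \<times> complex \<times> 'k) set"
  pins :: "'k \<Rightarrow> complex \<Rightarrow> 'k set"

text \<open>A point \<open>(k, d, z)\<close> lies on sheet \<open>k\<close> over \<open>z\<close>. The flag \<open>d\<close> tells the left bank (\<open>True\<close>) of a
  slit from its right bank; it is \<open>True\<close> by convention off the slits and at their end points.
  The point over an inner point of a seam stored on sheet \<open>k\<close> is the one on the left bank of
  sheet \<open>k\<close>.\<close>

type_synonym 'k point = "'k \<times> bool \<times> sphere"

definition proj :: "'k point \<Rightarrow> sphere" where
  "proj q = snd (snd q)"

definition points :: "'k sewing \<Rightarrow> 'k point set" where
  "points G = {(k, d, z). z \<in> region G k \<and>
     (d \<or> (\<exists>(A, B) \<in> slits G k. z \<in> Some ` open_segment A B))}"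

text \<open>If \<open>c\<close> is an inner point of a slit of sheet \<open>k\<close>: the points \<open>(k, d', v)\<close> near bank \<open>d\<close> of it.\<close>

definition on_bank :: "'k sewing \<Rightarrow> 'k \<Rightarrow> complex \<Rightarrow> bool \<Rightarrow> bool \<Rightarrow> complex \<Rightarrow> bool" where
  "on_bank G k c d d' v \<longleftrightarrow> (\<forall>(A, B) \<in> slits G k. c \<in> open_segment A B \<longrightarrow>
     (if v \<in> open_segment A B then d' = d else side A B d v))"

text \<open>If \<open>c\<close> is an inner point of a slit of sheet \<open>k\<close>: a segment \<open>[c, B]\<close> leaves from its bank \<open>d\<close>.\<close>

definition faces :: "'k sewing \<Rightarrow> 'k \<Rightarrow> complex \<Rightarrow> bool \<Rightarrow> complex \<Rightarrow> bool" where
  "faces G k c d B \<longleftrightarrow> (\<forall>(A', B') \<in> slits G k. c \<in> open_segment A' B' \<longrightarrow> side A' B' d B)"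

text \<open>\<open>adj G q q'\<close>: the points \<open>q'\<close> that belong to a small neighbourhood of \<open>q\<close>, provided that
  \<open>proj q'\<close> is close enough to \<open>proj q\<close>. To the right of a seam one enters the sheet glued there,
  elsewhere one stays on the sheet of \<open>q\<close> (and on the same bank of a slit).\<close>

definition adj :: "'k sewing \<Rightarrow> 'k point \<Rightarrow> 'k point \<Rightarrow> bool" where
  "adj G = (\<lambda>(k, d, z) (k', d', z'). case z of
      None \<Rightarrow> k' = k
    | Some c \<Rightarrow> (case z' of None \<Rightarrow> False | Some v \<Rightarrow>
        (k' = k \<and> on_bank G k c d d' v \<and>
          (\<forall>(A, B, l) \<in> seams G k.
             c \<in> closed_segment A B \<and> faces G k c d B \<longrightarrow> \<not> side A B False v))
      \<or> (\<exists>(A, B, l) \<in> seams G k.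
           c \<in> closed_segment A B \<and> faces G k c d B \<and> side A B False v \<and>
           k' = l \<and> (\<exists>e. faces G l c e B \<and> on_bank G l c e d' v))
      \<or> (pins G k c \<noteq> {} \<and> k' \<in> insert k (pins G k c))))"

definition surface_open :: "'k sewing \<Rightarrow> 'k point set \<Rightarrow> bool" where
  "surface_open G U \<longleftrightarrow> U \<subseteq> points G \<and>
     (\<forall>q\<in>U. \<exists>V. openin sphere_top V \<and> proj q \<in> V \<and>
        (\<forall>q'\<in>points G. proj q' \<in> V \<and> adj G q q' \<longrightarrow> q' \<in> U))"

definition surface :: "'k sewing \<Rightarrow> 'k point topology" where
  "surface G = topology (surface_open G)"

lemma istopology_surface_open: "istopology (surface_open G)"
proof -
  have "surface_open G (S \<inter> T)" if S: "surface_open G S" and T: "surface_open G T" for S T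
    unfolding surface_open_def
  proof (intro conjI ballI)
    show "S \<inter> T \<subseteq> points G" using S by (auto simp: surface_open_def)
    fix q assume q: "q \<in> S \<inter> T"
    obtain V where V: "openin sphere_top V" "proj q \<in> V"
        "\<forall>q'\<in>points G. proj q' \<in> V \<and> adj G q q' \<longrightarrow> q' \<in> S"
      using S q by (auto simp: surface_open_def)
    obtain W where W: "openin sphere_top W" "proj q \<in> W"
        "\<forall>q'\<in>points G. proj q' \<in> W \<and> adj G q q' \<longrightarrow> q' \<in> T"
      using T q by (auto simp: surface_open_def)
    show "\<exists>V. openin sphere_top V \<and> proj q \<in> V \<and>
        (\<forall>q'\<in>points G. proj q' \<in> V \<and> adj G q q' \<longrightarrow> q' \<in> S \<inter> T)"
      by (rule exI[of _ "V \<inter> W"]) (use V W in auto)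
  qed
  moreover have "surface_open G (\<Union>\<K>)" if K: "\<forall>S\<in>\<K>. surface_open G S" for \<K>
    unfolding surface_open_def
  proof (intro conjI ballI)
    show "\<Union>\<K> \<subseteq> points G" using K by (auto simp: surface_open_def)
    fix q assume "q \<in> \<Union>\<K>"
    then obtain S where S: "S \<in> \<K>" "q \<in> S" by blast
    then obtain V where "openin sphere_top V" "proj q \<in> V"
        "\<forall>q'\<in>points G. proj q' \<in> V \<and> adj G q q' \<longrightarrow> q' \<in> S"
      using K unfolding surface_open_def by meson
    then show "\<exists>V. openin sphere_top V \<and> proj q \<in> V \<and>
        (\<forall>q'\<in>points G. proj q' \<in> V \<and> adj G q q' \<longrightarrow> q' \<in> \<Union>\<K>)"
      using S(1) by blast
  qed
  ultimately show ?thesis by (simp add: istopology_def)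
qed

lemma openin_surface: "openin (surface G) = surface_open G"
  by (simp add: surface_def istopology_surface_open topology_inverse')


section \<open>The pants of a rational function\<close>

definition slots :: "(nat \<Rightarrow> real) \<Rightarrow> (real \<times> real) set" where
  "slots a = {(-1, 1), (a 1, a 2), (a 3, a 4)}"

definition slot_points :: "(nat \<Rightarrow> real) \<Rightarrow> sphere set" where
  "slot_points a = (\<Union>(l, r) \<in> slots a. (\<lambda>t. Some (complex_of_real t)) ` {l..r})"

text \<open>The left (\<open>True\<close>) bank of a slot is its upper bank.\<close>

definition pants_R :: "(nat \<Rightarrow> real) \<Rightarrow> unit sewing" where
  "pants_R a = \<lparr>region = (\<lambda>_. UNIV),
     slits = (\<lambda>_. (\<lambda>(l, r). (complex_of_real l, complex_of_real r)) ` slots a),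
     seams = (\<lambda>_. {}), pins = (\<lambda>_ _. {})\<rparr>"

definition over_slot :: "(nat \<Rightarrow> real) \<Rightarrow> real \<Rightarrow> real \<Rightarrow> unit point set" where
  "over_slot a l r = {q \<in> points (pants_R a). proj q \<in> (\<lambda>t. Some (complex_of_real t)) ` {l..r}}"

datatype colour = Red | Blue | Green

definition pants_R_colour :: "(nat \<Rightarrow> real) \<Rightarrow> colour \<Rightarrow> unit point set" where
  "pants_R_colour a x = (case x of Red \<Rightarrow> over_slot a (-1) 1
     | Blue \<Rightarrow> over_slot a (a 1) (a 2) | Green \<Rightarrow> over_slot a (a 3) (a 4))"


section \<open>The pants of three fashions\<close>

definition eps :: complex where
  "eps = cis (2 * pi / 3)"

definition mu :: "real \<Rightarrow> real" where
  "mu lam = sqrt ((3 - lam) / (2 * lam))"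

definition circle_C :: "real \<Rightarrow> complex set" where
  "circle_C lam = {p. (cmod (p - complex_of_real (inverse (mu lam))))\<^sup>2 = (inverse (mu lam))\<^sup>2 - 1}"

definition line :: "complex \<Rightarrow> complex set" where
  "line e = range (\<lambda>t. e * complex_of_real t)"

text \<open>The closed annulus between the circle \<open>insert None (Some ` line e)\<close> and \<open>circle_C lam\<close>: the part
  outside \<open>circle_C lam\<close> of the closed half-plane bounded by the line and containing the centre.\<close>

definition annulus :: "real \<Rightarrow> complex \<Rightarrow> sphere set" where
  "annulus lam e = insert None (Some ` {p.
     Im (p / e) * Im (complex_of_real (inverse (mu lam)) / e) \<ge> 0 \<and>
     (cmod (p - complex_of_real (inverse (mu lam))))\<^sup>2 \<ge> (inverse (mu lam))\<^sup>2 - 1})"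

text \<open>The straight segment from \<open>A\<close> joins \<open>A\<close> to \<open>circle_C lam\<close> inside \<open>X\<close>. It is not to be tangent to the
  circle at its end point, so that its line locally separates its two banks there.\<close>

definition joins :: "real \<Rightarrow> sphere set \<Rightarrow> complex \<times> complex \<Rightarrow> bool" where
  "joins lam X = (\<lambda>(A, B). A \<noteq> B \<and> B \<in> circle_C lam \<and>
     Some ` open_segment A B \<subseteq> sphere_top interior_of X \<and>
     Re ((A - B) * cnj (B - complex_of_real (inverse (mu lam)))) \<noteq> 0)"

definition seg :: "complex \<times> complex \<Rightarrow> complex set" where
  "seg g = closed_segment (fst g) (snd g)"

text \<open>\<open>Alpha\<close> and \<open>AlphaBar\<close> label the copies of the annuli \<open>annulus lam eps\<close> and \<open>annulus lam (eps\<^sup>2)\<close>.\<close>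

datatype sheet = Alpha nat | AlphaBar nat

text \<open>Fashion 1: \<open>g0\<close> is the cut from \<open>h\<close>, \<open>g1\<close> and \<open>g2\<close> are the cuts for the cyclic gluings.\<close>

definition cuts1 :: "real \<Rightarrow> complex \<Rightarrow> complex \<times> complex \<Rightarrow> complex \<times> complex \<Rightarrow>
    complex \<times> complex \<Rightarrow> bool" where
  "cuts1 lam h g0 g1 g2 \<longleftrightarrow>
     Some h \<in> sphere_top interior_of (annulus lam eps \<inter> annulus lam (eps\<^sup>2)) \<and>
     fst g0 = h \<and> joins lam (annulus lam eps \<inter> annulus lam (eps\<^sup>2)) g0 \<and>
     fst g1 \<in> line eps \<and> joins lam (annulus lam eps) g1 \<and> seg g1 \<inter> seg g0 = {} \<and>
     fst g2 \<in> line (eps\<^sup>2) \<and> joins lam (annulus lam (eps\<^sup>2)) g2 \<and> seg g2 \<inter> seg g0 = {}"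

definition pants1 :: "real \<Rightarrow> complex \<Rightarrow> nat \<Rightarrow> nat \<Rightarrow> complex \<times> complex \<Rightarrow>
    complex \<times> complex \<Rightarrow> complex \<times> complex \<Rightarrow> sheet sewing" where
  "pants1 lam h m1 m2 g0 g1 g2 = \<lparr>
     region = (\<lambda>k. case k of
         Alpha i \<Rightarrow> if i \<le> m1 then annulus lam eps else {}
       | AlphaBar j \<Rightarrow> if j \<le> m2 then annulus lam (eps\<^sup>2) - (if j = 0 then {Some h} else {}) else {}),
     slits = (\<lambda>_. {}),
     seams = (\<lambda>k. case k of
         Alpha i \<Rightarrow> {(fst g1, snd g1, Alpha ((i + 1) mod (m1 + 1)))} \<union>
                    (if i = 0 then {(fst g0, snd g0, AlphaBar 0)} else {})
       | AlphaBar j \<Rightarrow> {(fst g2, snd g2, AlphaBar ((j + 1) mod (m2 + 1)))} \<union>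
                    (if j = 0 then {(fst g0, snd g0, Alpha 0)} else {})),
     pins = (\<lambda>k z. if k = Alpha 0 \<and> z = h then {AlphaBar 0} else {})\<rparr>"

text \<open>Fashions 2 and 3 only differ by exchanging the roles of the two annuli. Sheet \<open>main 0\<close> over
  \<open>annulus lam e\<close> has the slit \<open>-f [h1, h2]\<close>; \<open>n\<close> further copies \<open>main i\<close> are glued in along \<open>g\<close>,
  and \<open>n'\<close> copies \<open>other j\<close>, \<open>1 \<le> j \<le> n'\<close>, of \<open>annulus lam f\<close> along the cut \<open>g'\<close> starting from the slit.
  The surface does not depend on the choice of the starting point of \<open>g'\<close>,
  which is taken different from the ends of the slit.\<close>

definition slit_ends :: "complex \<Rightarrow> real \<Rightarrow> real \<Rightarrow> complex \<times> complex" where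
  "slit_ends f h1 h2 = (- f * complex_of_real h1, - f * complex_of_real h2)"

definition cuts_slit :: "real \<Rightarrow> complex \<Rightarrow> complex \<Rightarrow> real \<Rightarrow> real \<Rightarrow>
    complex \<times> complex \<Rightarrow> complex \<times> complex \<Rightarrow> bool" where
  "cuts_slit lam e f h1 h2 g g' \<longleftrightarrow> 0 < h1 \<and> h1 < h2 \<and>
     fst g \<in> line e \<and> joins lam (annulus lam e) g \<and> seg g \<inter> seg (slit_ends f h1 h2) = {} \<and>
     fst g' \<in> open_segment (fst (slit_ends f h1 h2)) (snd (slit_ends f h1 h2)) \<and>
     joins lam (annulus lam e \<inter> annulus lam f) g' \<and> seg g \<inter> seg g' = {}"

definition pants_slit :: "(nat \<Rightarrow> sheet) \<Rightarrow> (nat \<Rightarrow> sheet) \<Rightarrow> real \<Rightarrow> complex \<Rightarrow> complex \<Rightarrow>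
    real \<Rightarrow> real \<Rightarrow> nat \<Rightarrow> nat \<Rightarrow> complex \<times> complex \<Rightarrow> complex \<times> complex \<Rightarrow> sheet sewing" where
  "pants_slit main other lam e f h1 h2 n n' g g' = (let cyc = (\<lambda>j. if j = 0 then main 0 else other j) in \<lparr>
     region = (\<lambda>k. if k \<in> main ` {0..n} then annulus lam e
                   else if k \<in> other ` {1..n'} then annulus lam f else {}),
     slits = (\<lambda>k. if k = main 0 then {slit_ends f h1 h2} else {}),
     seams = (\<lambda>k. {(fst g, snd g, main ((i + 1) mod (n + 1))) |i. i \<le> n \<and> k = main i} \<union>
                  {(fst g', snd g', cyc ((j + 1) mod (n' + 1))) |j. j \<le> n' \<and> k = cyc j}),
     pins = (\<lambda>_ _. {})\<rparr>)"

definition admissible_cuts :: "nat \<Rightarrow> real \<Rightarrow> real \<Rightarrow> real \<Rightarrow> complex \<times> complex \<Rightarrow>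
    complex \<times> complex \<Rightarrow> complex \<times> complex \<Rightarrow> bool" where
  "admissible_cuts s lam h1 h2 g0 g1 g2 \<longleftrightarrow>
     (if s = 1 then cuts1 lam (Complex h1 h2) g0 g1 g2
      else if s = 2 then cuts_slit lam eps (eps\<^sup>2) h1 h2 g1 g2
      else cuts_slit lam (eps\<^sup>2) eps h1 h2 g2 g1)"

text \<open>\<open>pants s\<close> is meant for \<open>s \<in> {1, 2, 3}\<close>; the cut \<open>g0\<close> only plays a role for \<open>s = 1\<close>.\<close>

definition pants :: "nat \<Rightarrow> real \<Rightarrow> real \<Rightarrow> real \<Rightarrow> nat \<Rightarrow> nat \<Rightarrow> complex \<times> complex \<Rightarrow>
    complex \<times> complex \<Rightarrow> complex \<times> complex \<Rightarrow> sheet sewing" where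
  "pants s lam h1 h2 m1 m2 g0 g1 g2 =
     (if s = 1 then pants1 lam (Complex h1 h2) m1 m2 g0 g1 g2
      else if s = 2 then pants_slit Alpha AlphaBar lam eps (eps\<^sup>2) h1 h2 m1 m2 g1 g2
      else pants_slit AlphaBar Alpha lam (eps\<^sup>2) eps h1 h2 m2 m1 g2 g1)"

text \<open>A coloured boundary point lies over \<open>circle_C lam\<close> (red), on an \<open>Alpha\<close> sheet over the circle of
  \<open>eps\<close> (green), on an \<open>AlphaBar\<close> sheet over the circle of \<open>eps\<^sup>2\<close> (blue), or on the slit.\<close>

definition pants_colour :: "nat \<Rightarrow> real \<Rightarrow> real \<Rightarrow> real \<Rightarrow> sheet sewing \<Rightarrow> colour \<Rightarrow> sheet point set" where
  "pants_colour s lam h1 h2 G x = {(k, d, z) \<in> points G. case x of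
      Red \<Rightarrow> z \<in> Some ` circle_C lam
    | Green \<Rightarrow> (\<exists>i. k = Alpha i) \<and> z \<in> insert None (Some ` line eps) \<or>
               s = 3 \<and> k = AlphaBar 0 \<and> z \<in> Some ` seg (slit_ends eps h1 h2)
    | Blue \<Rightarrow> (\<exists>j. k = AlphaBar j) \<and> z \<in> insert None (Some ` line (eps\<^sup>2)) \<or>
               s = 2 \<and> k = Alpha 0 \<and> z \<in> Some ` seg (slit_ends (eps\<^sup>2) h1 h2)}"


section \<open>Conformal maps between pants and their critical points\<close>

text \<open>The complex structure of the target is the one for which \<open>proj\<close> is holomorphic; hence a
  homeomorphism is conformal iff its composition with \<open>proj\<close> is holomorphic (with values in the
  sphere) at the inner points of the source.\<close>

definition conformal_pants_map :: "(nat \<Rightarrow> real) \<Rightarrow> nat \<Rightarrow> real \<Rightarrow> real \<Rightarrow> real \<Rightarrow> sheet sewing \<Rightarrow>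
    (unit point \<Rightarrow> sheet point) \<Rightarrow> bool" where
  "conformal_pants_map a s lam h1 h2 G F \<longleftrightarrow>
     homeomorphic_map (surface (pants_R a)) (surface G) F \<and>
     (\<forall>z. z \<notin> slot_points a \<longrightarrow>
        (\<lambda>t. chart (proj (F ((), True, z))) (proj (F ((), True, chart_inv z t)))) analytic_on {0}) \<and>
     (\<forall>x. F ` pants_R_colour a x = pants_colour s lam h1 h2 G x)"

text \<open>The function \<open>p\<close> on the interior of the pants, its values on the banks \<open>y \<plusminus> i0\<close> of a slot (sign +
  for \<open>d = True\<close>), and the boundary values of its derivative there.\<close>

definition pfun :: "(unit point \<Rightarrow> sheet point) \<Rightarrow> complex \<Rightarrow> complex" where
  "pfun F z = the (proj (F ((), True, Some z)))"

definition p_bank :: "(unit point \<Rightarrow> sheet point) \<Rightarrow> bool \<Rightarrow> real \<Rightarrow> complex" where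
  "p_bank F d y = the (proj (F ((), d, Some (complex_of_real y))))"

definition dp_bank :: "(unit point \<Rightarrow> sheet point) \<Rightarrow> bool \<Rightarrow> real \<Rightarrow> complex" where
  "dp_bank F d y = Lim (at_right 0)
     (\<lambda>t. deriv (pfun F) (Complex y (if d then t else - t)))"

text \<open>Inverse of a local parameter of the double at the boundary point over \<open>y\<close> on bank \<open>d\<close>; it maps a
  half-disc \<open>Im t > 0\<close> into the interior of the pants. At the ends of a slot it inverts
  the square root of \<open>\<plusminus>(z - y)\<close>.\<close>

definition boundary_param :: "(nat \<Rightarrow> real) \<Rightarrow> bool \<Rightarrow> real \<Rightarrow> complex \<Rightarrow> complex" where
  "boundary_param a d y t =
     (if y \<in> fst ` slots a then complex_of_real y + t\<^sup>2
      else if y \<in> snd ` slots a then complex_of_real y - t\<^sup>2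
      else if d then complex_of_real y + t else complex_of_real y - t)"

definition critical_points :: "(nat \<Rightarrow> real) \<Rightarrow> (unit point \<Rightarrow> sheet point) \<Rightarrow> unit point set" where
  "critical_points a F =
     {((), True, z) |z. z \<notin> slot_points a \<and>
        deriv (\<lambda>t. chart (proj (F ((), True, z))) (proj (F ((), True, chart_inv z t)))) 0 = 0} \<union>
     {((), d, Some (complex_of_real y)) |d y.
        ((), d, Some (complex_of_real y)) \<in> points (pants_R a) \<and>
        Some (complex_of_real y) \<in> slot_points a \<and>
        (deriv (\<lambda>t. chart (proj (F ((), d, Some (complex_of_real y))))
                     (proj (F ((), True, Some (boundary_param a d y t))))) \<longlongrightarrow> 0)
          (at 0 within {t. Im t > 0})}"


section \<open>The integral equation and the eigenfunction\<close>

text \<open>Cauchy principal value over \<open>[-1, 1]\<close> at the singular point \<open>x\<close>.\<close>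

definition has_pv_integral :: "(real \<Rightarrow> complex) \<Rightarrow> real \<Rightarrow> complex \<Rightarrow> bool" where
  "has_pv_integral f x I \<longleftrightarrow>
     ((\<lambda>r. integral {-1..x - r} f + integral {x + r..1} f) \<longlongrightarrow> I) (at_right 0)"

definition solves_equation :: "real \<Rightarrow> (real \<Rightarrow> real) \<Rightarrow> (real \<Rightarrow> complex) \<Rightarrow> bool" where
  "solves_equation lam R u \<longleftrightarrow> (\<exists>const. \<forall>x\<in>{-1<..<1}. \<exists>I J.
     has_pv_integral (\<lambda>t. u t / complex_of_real (t - x)) x I \<and>
     has_pv_integral (\<lambda>t. u t * complex_of_real (deriv R t) / complex_of_real (R t - R x)) x J \<and>
     complex_of_real lam * I - J = const)"

definition w_squared :: "(nat \<Rightarrow> real) \<Rightarrow> real \<Rightarrow> real" where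
  "w_squared a y = (y\<^sup>2 - 1) * (\<Prod>s=1..4. (y - a s))"

text \<open>\<open>S\<close> and \<open>w\<close> are continuous branches of the two square roots in the formula for \<open>u\<close>.
  At \<open>x = \<plusminus>1\<close>, where the formula is indeterminate, \<open>u\<close> is extended by continuity.\<close>

definition eigenfunction_formula :: "(nat \<Rightarrow> real) \<Rightarrow> (real \<Rightarrow> real) \<Rightarrow>
    (unit point \<Rightarrow> sheet point) \<Rightarrow> complex \<Rightarrow> complex \<Rightarrow> (real \<Rightarrow> complex) \<Rightarrow> bool" where
  "eigenfunction_formula a R F y1 y2 u \<longleftrightarrow> continuous_on {-1..1} u \<and>
     (\<exists>S w. continuous_on {-1<..<1} S \<and> continuous_on {-1<..<1} w \<and>
       (\<forall>x\<in>{-1<..<1}. let y = R x in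
          (S x)\<^sup>2 = (complex_of_real y - y1) * (complex_of_real y - y2) /
                     (dp_bank F True y * dp_bank F False y) \<and>
          (w x)\<^sup>2 = complex_of_real (w_squared a y) \<and>
          u x = S x * ((p_bank F True y - p_bank F False y) / w x)))"

end

theory Submission
  imports Defs
begin

text \<open>Write \<open>y = cos \<tau>\<close>. The two banks of \<open>[-1, 1]\<close> become the real \<open>\<tau>\<close>-axis modulo \<open>2 * pi\<close>, and a
  half-neighbourhood of the slot becomes a strip above it, on which
  \<open>p = m + r * exp (- \<i> * \<Psi>)\<close> for the centre \<open>m\<close> and the radius \<open>r\<close> of \<open>circle_C\<close>.
  Since the red boundary goes to this circle and the rest of the pants to its exterior, \<open>\<Psi>\<close> is real on
  the axis and has positive imaginary part above it. Its reflection is therefore holomorphic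
  with positive derivative along the axis, whatever seams end on the circle.
  So \<open>\<Psi>\<close> grows by \<open>2 * pi * d\<close> over a period, where \<open>d\<close> is the number of points over a point of the
  circle, that is, the number of sheets. With \<open>y = cos t\<close>, \<open>0 < t < pi\<close>, the equation
  \<open>p (y + \<i>0) = p (y - \<i>0)\<close> says that the increasing quantity \<open>\<Psi> t - \<Psi> (- t)\<close>, which runs from \<open>0\<close>
  to \<open>2 * pi * d\<close>, is a multiple of \<open>2 * pi\<close>: it has \<open>d - 1\<close> solutions. The other factors of \<open>u\<close> do not
  vanish there, because \<open>\<Psi>\<close> has no critical points on the axis, and the two end points are zeros
  as well, because \<open>1 / p'\<close> cancels the singularity of \<open>1 / w\<close>.\<close>

section \<open>Boundary behaviour of holomorphic maps\<close>

text \<open>At a zero of order \<open>n\<close> of \<open>f z - f x\<close> angles are multiplied by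
  \<open>n\<close>. A half-disc above the axis then spreads over the angle \<open>n * pi\<close>,
  and its image can stay in the upper half-plane only if \<open>n = 1\<close> and the leading
  coefficient is positive.\<close>

lemma deriv_pos_of_upper_half_plane:
  assumes hol: "f holomorphic_on S" and S: "open S" "connected S"
    and x: "complex_of_real x \<in> S"
    and real: "\<And>z. z \<in> S \<Longrightarrow> Im z = 0 \<Longrightarrow> Im (f z) = 0"
    and pos: "\<And>z. z \<in> S \<Longrightarrow> Im z > 0 \<Longrightarrow> Im (f z) > 0"
  shows "Re (deriv f (complex_of_real x)) > 0"
proof -
  define z0 where "z0 = complex_of_real x"
  define h where "h = (\<lambda>z. f z - f z0)"
  obtain e where e: "e > 0" "ball z0 e \<subseteq> S"
    using S x openE z0_def by blast
  \<comment> \<open>At this point above the axis \<open>f\<close> has positive imaginary part, while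
    \<open>f z0\<close> is real; so \<open>h\<close> is not constant and its zero at
    \<open>z0\<close> has finite order.\<close>
  have "z0 + \<i> * of_real (e/2) \<in> S"
    using e by (auto simp: dist_norm norm_mult subset_iff)
  then have "Im (f (z0 + \<i> * of_real (e/2))) > 0"
    using e by (intro pos) (auto simp: z0_def)
  moreover have imz0: "Im (f z0) = 0"
    using x by (intro real) (auto simp: z0_def)
  ultimately have "h (z0 + \<i> * of_real (e/2)) \<noteq> h z0"
    by (auto simp: h_def)
  then have "\<not> h constant_on S"
    using \<open>z0 + \<i> * of_real (e/2) \<in> S\<close> x unfolding constant_on_def z0_def by metis
  moreover have "h holomorphic_on S" "h z0 = 0"
    by (auto simp: h_def intro!: holomorphic_intros hol)
  ultimately obtain g r n where g: "0 < n" "0 < r" "ball z0 r \<subseteq> S"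
      "g holomorphic_on ball z0 r"
      "\<And>w. w \<in> ball z0 r \<Longrightarrow> h w = (w - z0)^n * g w"
      "\<And>w. w \<in> ball z0 r \<Longrightarrow> g w \<noteq> 0"
    using holomorphic_factor_zero_nonconstant[of h S z0] S x z0_def by metis
  have gcont: "isCont g z0"
    using g(2,4) holomorphic_on_imp_continuous_on continuous_on_interior by fastforce
  have lim: "((\<lambda>t. g (z0 + of_real t * v)) \<longlongrightarrow> g z0) (at_right 0)" for v
  proof (rule isCont_tendsto_compose[OF gcont])
    have "((\<lambda>t. z0 + of_real t * v) \<longlongrightarrow> z0 + of_real 0 * v) (at_right 0)"
      by (intro tendsto_intros)
    then show "((\<lambda>t. z0 + of_real t * v) \<longlongrightarrow> z0) (at_right 0)" by simp
  qed
  have small: "\<forall>\<^sub>F t in at_right 0. z0 + of_real t * v \<in> ball z0 r \<and> t > 0" for v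
  proof -
    have "((\<lambda>t. z0 + of_real t * v) \<longlongrightarrow> z0 + of_real 0 * v) (at_right 0)"
      by (intro tendsto_intros)
    then have "\<forall>\<^sub>F t in at_right 0. z0 + of_real t * v \<in> ball z0 r"
      using g(2) by (intro topological_tendstoD) auto
    then show ?thesis
      using eventually_at_right_less[of "0::real"] by eventually_elim auto
  qed
  \<comment> \<open>Along the axis to the right of \<open>z0\<close> both \<open>h\<close> and the
    power of \<open>z - z0\<close> are real.\<close>
  have g0real: "Im (g z0) = 0"
  proof -
    have "\<forall>\<^sub>F t in at_right 0. Im (g (z0 + of_real t * 1)) = 0"
      using small[of 1]
    proof eventually_elim
      case (elim t)
      have "Im (h (z0 + of_real t * 1)) = 0"
        using elim g(3) imz0 by (auto simp: h_def z0_def intro!: real)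
      moreover have "h (z0 + of_real t * 1) = of_real (t ^ n) * g (z0 + of_real t * 1)"
        using g(5)[of "z0 + of_real t * 1"] elim by simp
      ultimately show ?case using elim by (auto simp del: of_real_power)
    qed
    then have "((\<lambda>t. Im (g (z0 + of_real t * 1))) \<longlongrightarrow> 0) (at_right 0)"
      by (rule tendsto_eventually)
    moreover have "((\<lambda>t. Im (g (z0 + of_real t * 1))) \<longlongrightarrow> Im (g z0)) (at_right 0)"
      by (intro tendsto_intros lim)
    ultimately show ?thesis
      using tendsto_unique[OF trivial_limit_at_right_real] by blast
  qed
  \<comment> \<open>On the ray of angle \<open>\<alpha>\<close> the power contributes the direction
    \<open>cis (real n * \<alpha>)\<close>; only the weak inequality survives the limit at
    \<open>z0\<close>.\<close>
  have sector: "Im (cis (real n * \<alpha>) * g z0) \<ge> 0" if \<alpha>: "0 < \<alpha>" "\<alpha> < pi" for \<alpha> :: real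
  proof -
    have "\<forall>\<^sub>F t in at_right 0. 0 \<le> Im (cis (real n * \<alpha>) * g (z0 + of_real t * cis \<alpha>))"
      using small[of "cis \<alpha>"]
    proof eventually_elim
      case (elim t)
      have "Im (h (z0 + of_real t * cis \<alpha>)) > 0"
        using elim g(3) imz0 \<alpha> sin_gt_zero by (auto simp: h_def z0_def intro!: pos)
      moreover have "h (z0 + of_real t * cis \<alpha>) =
          of_real (t ^ n) * (cis (real n * \<alpha>) * g (z0 + of_real t * cis \<alpha>))"
        using g(5)[of "z0 + of_real t * cis \<alpha>"] elim
        by (simp add: power_mult_distrib Complex.DeMoivre)
      moreover have "Im (of_real s * w) = s * Im w" for s w
        by simp
      ultimately have "0 < t ^ n * Im (cis (real n * \<alpha>) * g (z0 + of_real t * cis \<alpha>))"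
        by metis
      then show ?case using elim by (simp add: zero_less_mult_iff del: times_complex.sel)
    qed
    moreover have "((\<lambda>t. Im (cis (real n * \<alpha>) * g (z0 + of_real t * cis \<alpha>))) \<longlongrightarrow>
         Im (cis (real n * \<alpha>) * g z0)) (at_right 0)"
      by (intro tendsto_intros lim)
    ultimately show ?thesis
      using tendsto_lowerbound[OF _ _ trivial_limit_at_right_real] by blast
  qed
  have g0: "Re (g z0) \<noteq> 0"
    using g0real g(6)[of z0] g(2) by (auto simp: complex_eq_iff)
  have npos: "real n > 0" using g(1) by simp
  \<comment> \<open>For this angle the direction is \<open>\<i>\<close>, so the imaginary part in
    \<open>sector\<close> becomes \<open>Re (g z0)\<close>.\<close>
  have "pi / (2 * n) < pi" using npos g(1) by (simp add: field_simps)
  then have "0 \<le> Im (cis (real n * (pi / (2 * n))) * g z0)"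
    using npos by (intro sector) auto
  then have gpos: "Re (g z0) > 0"
    using npos g0 by simp
  have "n = 1"
  proof (rule ccontr)
    assume "n \<noteq> 1"
    then have n2: "real n \<ge> 2" using g(1) by linarith
    \<comment> \<open>From \<open>n = 2\<close> on this angle still lies below \<open>pi\<close>;
      its direction is \<open>- \<i>\<close>, which would make \<open>Re (g z0)\<close>
      nonpositive.\<close>
    have "3 * pi / (2 * n) < pi" using n2 by (simp add: field_simps)
    then have "0 \<le> Im (cis (real n * (3 * pi / (2 * n))) * g z0)"
      using npos by (intro sector) auto
    moreover have "n * (3 * pi / (2 * n)) = pi + pi / 2" using npos by (simp add: field_simps)
    moreover have "cis (pi + pi / 2) = - \<i>"
      by (simp only: complex_eq_iff cis.sel sin_add cos_add) simp
    ultimately have "0 \<le> Im (- \<i> * g z0)" by metis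
    then show False
      using gpos by simp
  qed
  have der: "((\<lambda>w. (w - z0) * g w) has_field_derivative g z0) (at z0)"
    using holomorphic_derivI[OF g(4), of z0] g(2) by (auto intro!: derivative_eq_intros)
  have "(h has_field_derivative g z0) (at z0)"
  proof -
    have "\<forall>\<^sub>F w in nhds z0. h w = (w - z0) * g w"
      using g(2) \<open>n = 1\<close>
      by (intro eventually_mono[OF eventually_nhds_in_open[of "ball z0 r" z0]]) (simp_all add: g(5))
    from DERIV_cong_ev[OF refl this refl] der show ?thesis by simp
  qed
  then have "((\<lambda>z. h z + f z0) has_field_derivative g z0) (at z0)"
    by (auto intro!: derivative_eq_intros)
  then have "(f has_field_derivative g z0) (at z0)"
    by (simp add: h_def)
  then have "deriv f z0 = g z0" by (rule DERIV_imp_deriv)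
  then show ?thesis using gpos by (simp add: z0_def)
qed

text \<open>Locally \<open>g\<close> is a branch of the logarithm of \<open>f\<close>: by continuity
  \<open>g w - g z\<close> is so small that \<open>Ln\<close> inverts \<open>exp\<close> on
  it.\<close>

lemma holomorphic_of_exp_holomorphic:
  assumes S: "open S" and hol: "f holomorphic_on S"
    and cont: "continuous_on S g" and eq: "\<And>z. z \<in> S \<Longrightarrow> f z = exp (g z)"
  shows "g holomorphic_on S"
proof -
  have "g field_differentiable at z" if z: "z \<in> S" for z
  proof -
    obtain e where e: "e > 0" "ball z e \<subseteq> S" "\<And>w. w \<in> ball z e \<Longrightarrow> dist (g w) (g z) < 1"
    proof -
      have "isCont g z" using cont S z continuous_on_eq_continuous_at by blast
      then have "\<forall>\<^sub>F w in nhds z. dist (g w) (g z) < 1"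
        by (metis zero_less_one isCont_def tendsto_at_iff_tendsto_nhds tendstoD)
      moreover have "\<forall>\<^sub>F w in nhds z. w \<in> S"
        using S z eventually_nhds_in_open by blast
      ultimately have "\<forall>\<^sub>F w in nhds z. w \<in> S \<and> dist (g w) (g z) < 1"
        by eventually_elim auto
      then show ?thesis using that by (auto simp: eventually_nhds_metric dist_commute subset_iff)
    qed
    have loc: "g w = Ln (f w / f z) + g z" if w: "w \<in> ball z e" for w
    proof -
      have "\<bar>Im (g w - g z)\<bar> < 1"
        using e(3)[OF w] abs_Im_le_cmod[of "g w - g z"] by (simp add: dist_norm)
      then have "Ln (exp (g w - g z)) = g w - g z"
        using pi_gt3 by (intro Ln_exp) auto
      moreover have "f w / f z = exp (g w - g z)"
        using e(2) w z by (simp add: eq exp_diff subset_iff)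
      ultimately show ?thesis by simp
    qed
    have ev: "\<forall>\<^sub>F w in nhds z. g w = Ln (f w / f z) + g z"
      by (rule eventually_mono[OF eventually_nhds_in_open[of "ball z e" z]]) (use e(1) in simp, use e(1) in simp, rule loc)
    obtain f' where f': "(f has_field_derivative f') (at z)"
      using hol S z holomorphic_derivI by blast
    have "f z \<noteq> 0" using eq z by simp
    then have "((\<lambda>w. Ln (f w / f z) + g z) has_field_derivative f' / f z) (at z)"
      by (auto intro!: derivative_eq_intros f')
    then have "(g has_field_derivative f' / f z) (at z)"
      using DERIV_cong_ev[OF refl ev refl] by simp
    then show ?thesis by (auto simp: field_differentiable_def)
  qed
  then show ?thesis
    by (simp add: holomorphic_on_def field_differentiable_at_within)
qed

text \<open>The argument of \<open>g\<close> along the axis extends by reflection, since it is real there. It increases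
  because its imaginary part above the axis, \<open>ln (cmod (g z))\<close>, is positive.\<close>

lemma boundary_argument:
  fixes g :: "complex \<Rightarrow> complex"
  assumes d: "\<delta> > 0"
    and cont: "continuous_on {z. 0 \<le> Im z \<and> Im z < \<delta>} g"
    and hol: "g holomorphic_on {z. 0 < Im z \<and> Im z < \<delta>}"
    and unit: "\<And>x. cmod (g (complex_of_real x)) = 1"
    and outer: "\<And>z. 0 < Im z \<Longrightarrow> Im z < \<delta> \<Longrightarrow> cmod (g z) > 1"
    and per: "\<And>x. g (complex_of_real (x + 2 * pi)) = g (complex_of_real x)"
  obtains \<psi> \<psi>' :: "real \<Rightarrow> real" and D :: int
  where "\<And>x. (\<psi> has_real_derivative \<psi>' x) (at x)" "continuous_on UNIV \<psi>'" "\<And>x. \<psi>' x > 0"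
    "\<And>x. g (complex_of_real x) = cis (- \<psi> x)"
    "\<And>x. ((\<lambda>z. deriv g z) \<longlongrightarrow> - \<i> * complex_of_real (\<psi>' x) * cis (- \<psi> x))
        (at (complex_of_real x) within {z. 0 < Im z})"
    "\<psi> pi - \<psi> (- pi) = 2 * pi * of_int D"
proof -
  define T where "T = {z::complex. 0 \<le> Im z \<and> Im z < \<delta>}"
  define S where "S = {z::complex. \<bar>Im z\<bar> < \<delta>}"
  have "T = {z. 0 \<le> Im z} \<inter> {z. Im z < \<delta>}" by (auto simp: T_def)
  then have "convex T"
    by (simp add: convex_Int convex_halfspace_Im_ge convex_halfspace_Im_lt)
  have "S = {z. Im z > -\<delta>} \<inter> {z. Im z < \<delta>}" by (auto simp: S_def)
  then have S: "open S" "connected S"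
    by (auto simp: open_Int open_halfspace_Im_gt open_halfspace_Im_lt
          intro!: convex_connected convex_Int convex_halfspace_Im_gt convex_halfspace_Im_lt)
  have unit0: "cmod (g z) = 1" if "Im z = 0" for z
    using unit[of "Re z"] that by (metis complex_is_Real_iff of_real_Re)
  have gnz: "g z \<noteq> 0" if "z \<in> T" for z
  proof (cases "Im z = 0")
    case True
    then show ?thesis using unit0[of z] by auto
  next
    case False
    then show ?thesis using outer[of z] that by (auto simp: T_def)
  qed
  \<comment> \<open>The strip is convex, hence contractible, and \<open>g\<close> has no zero on it,
    so a logarithm exists that is continuous up to the axis.\<close>
  obtain H where H: "continuous_on T H" "\<And>z. z \<in> T \<Longrightarrow> g z = exp (H z)"
    using continuous_logarithm_on_contractible[of T g] cont gnz \<open>convex T\<close> convex_imp_contractible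
    by (metis T_def)
  define U where "U = {z::complex. 0 < Im z \<and> Im z < \<delta>}"
  have "U = {z. Im z > 0} \<inter> {z. Im z < \<delta>}" by (auto simp: U_def)
  then have "open U"
    by (auto simp: open_Int open_halfspace_Im_gt open_halfspace_Im_lt)
  have holH: "H holomorphic_on U"
  proof (rule holomorphic_of_exp_holomorphic[OF \<open>open U\<close>])
    show "g holomorphic_on U" using hol by (simp add: U_def)
    show "continuous_on U H" using H(1) by (rule continuous_on_subset) (auto simp: U_def T_def)
  qed (use H(2) in \<open>auto simp: U_def T_def\<close>)
  \<comment> \<open>The factor \<open>\<i>\<close> turns the unimodular boundary values of
    \<open>g\<close> into real values of \<open>L\<close>, as the reflection principle
    requires.\<close>
  define L where "L = (\<lambda>z. \<i> * H z)"
  have gL: "g z = exp (- \<i> * L z)" if "z \<in> T" for z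
    using H(2)[OF that] by (simp add: L_def mult.assoc[symmetric])
  have ImL: "Im (L z) = ln (cmod (g z))" if "z \<in> T" for z
    using H(2)[OF that] by (simp add: L_def)
  define \<Psi> where "\<Psi> = (\<lambda>z. if 0 \<le> Im z then L z else cnj (L (cnj z)))"
  have hol\<Psi>: "\<Psi> holomorphic_on S"
    unfolding \<Psi>_def
  proof (rule Schwarz_reflection)
    show "L holomorphic_on S \<inter> {z. 0 < Im z}"
      unfolding L_def
      by (intro holomorphic_intros holomorphic_on_subset[OF holH]) (auto simp: S_def U_def)
    show "continuous_on (S \<inter> {z. 0 \<le> Im z}) L"
      unfolding L_def
      by (intro continuous_intros continuous_on_subset[OF H(1)]) (auto simp: S_def T_def)
    show "L z \<in> \<real>" if "z \<in> S" "z \<in> \<real>" for z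
      using that ImL[of z] unit0[of z] d by (simp add: complex_is_Real_iff T_def)
  qed (auto simp: S_def \<open>open S\<close>[unfolded S_def])
  have xS: "complex_of_real x \<in> S" "complex_of_real x \<in> T" for x using d by (auto simp: S_def T_def)
  have real\<Psi>: "Im (\<Psi> z) = 0" if "z \<in> S" "Im z = 0" for z
    using that ImL[of z] unit0[of z] d by (simp add: \<Psi>_def T_def)
  define \<psi> where "\<psi> = (\<lambda>x. Re (\<Psi> (complex_of_real x)))"
  define \<psi>' where "\<psi>' = (\<lambda>x. Re (deriv \<Psi> (complex_of_real x)))"
  have \<psi>: "\<Psi> (complex_of_real x) = of_real (\<psi> x)" for x
    using real\<Psi>[OF xS(1)] by (simp add: \<psi>_def complex_eq_iff)
  have der: "(\<Psi> has_field_derivative deriv \<Psi> z) (at z)" if "z \<in> S" for z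
    using hol\<Psi> S(1) that by (rule holomorphic_derivI)
  have der\<psi>: "(\<psi> has_real_derivative \<psi>' x) (at x)" for x
  proof -
    have "((\<lambda>x. \<Psi> (complex_of_real x)) has_vector_derivative deriv \<Psi> (complex_of_real x)) (at x)"
      using der[OF xS(1)] by (rule has_vector_derivative_real_field)
    from bounded_linear.has_vector_derivative[OF bounded_linear_Re this]
    have "((\<lambda>x. Re (\<Psi> (complex_of_real x))) has_vector_derivative Re (deriv \<Psi> (complex_of_real x))) (at x)"
      .
    then show ?thesis
      by (simp add: \<psi>_def \<psi>'_def has_real_derivative_iff_has_vector_derivative)
  qed
  \<comment> \<open>\<open>\<Psi>\<close> is real along the axis, hence so is its derivative, which
    can be taken in the direction of the axis.\<close>
  have d\<psi>: "deriv \<Psi> (complex_of_real x) = of_real (\<psi>' x)" for x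
  proof -
    have "((\<lambda>x. \<Psi> (complex_of_real x)) has_vector_derivative deriv \<Psi> (complex_of_real x)) (at x)"
      using der[OF xS(1)] by (rule has_vector_derivative_real_field)
    from bounded_linear.has_vector_derivative[OF bounded_linear_Im this]
    have "((\<lambda>x. Im (\<Psi> (complex_of_real x))) has_vector_derivative Im (deriv \<Psi> (complex_of_real x))) (at x)"
      .
    then have "((\<lambda>x::real. 0::real) has_vector_derivative Im (deriv \<Psi> (complex_of_real x))) (at x)"
      by (simp add: \<psi>)
    then have "Im (deriv \<Psi> (complex_of_real x)) = 0"
      using vector_derivative_unique_at has_vector_derivative_const by blast
    then show ?thesis by (simp add: \<psi>'_def complex_eq_iff)
  qed
  have cont': "continuous_on S (deriv \<Psi>)"
    using hol\<Psi> S(1) holomorphic_deriv holomorphic_on_imp_continuous_on by blast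
  have pos: "\<psi>' x > 0" for x
    unfolding \<psi>'_def
  proof (rule deriv_pos_of_upper_half_plane[OF hol\<Psi> S xS(1) real\<Psi>])
    fix z assume "z \<in> S" "Im z > 0"
    then show "Im (\<Psi> z) > 0"
      using ImL[of z] outer[of z] ln_gt_zero[of "cmod (g z)"] by (simp add: \<Psi>_def T_def S_def)
  qed
  have gx: "g (complex_of_real x) = cis (- \<psi> x)" for x
  proof -
    have "L (complex_of_real x) = of_real (\<psi> x)" using \<psi>[of x] by (simp add: \<Psi>_def)
    then have "g (complex_of_real x) = exp (- \<i> * of_real (\<psi> x))" using gL[OF xS(2), of x] by argo
    then show ?thesis by (simp add: cis_conv_exp)
  qed
  \<comment> \<open>Above the axis \<open>g\<close> is \<open>exp (- \<i> * \<Psi>)\<close>, and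
    after the reflection \<open>\<Psi>\<close> and \<open>deriv \<Psi>\<close> are continuous at
    \<open>x\<close>; this gives \<open>deriv g\<close> its boundary values.\<close>
  have lim: "((\<lambda>z. deriv g z) \<longlongrightarrow> - \<i> * complex_of_real (\<psi>' x) * cis (- \<psi> x))
        (at (complex_of_real x) within {z. 0 < Im z})" for x
  proof -
    have c: "isCont \<Psi> (complex_of_real x)" "isCont (deriv \<Psi>) (complex_of_real x)"
      using cont' holomorphic_on_imp_continuous_on[OF hol\<Psi>] xS(1)
      by (simp_all add: continuous_on_eq_continuous_at[OF S(1)])
    have "((\<lambda>z. - \<i> * deriv \<Psi> z * exp (- \<i> * \<Psi> z)) \<longlongrightarrow>
        - \<i> * deriv \<Psi> (complex_of_real x) * exp (- \<i> * \<Psi> (complex_of_real x)))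
        (at (complex_of_real x) within {z. 0 < Im z})"
      using c by (intro tendsto_intros) (auto simp: isCont_def intro: tendsto_within_subset)
    moreover have "- \<i> * deriv \<Psi> (complex_of_real x) * exp (- \<i> * \<Psi> (complex_of_real x)) =
        - \<i> * complex_of_real (\<psi>' x) * cis (- \<psi> x)"
      by (simp add: \<psi> d\<psi> cis_conv_exp)
    moreover have "\<forall>\<^sub>F z in at (complex_of_real x) within {z. 0 < Im z}.
        - \<i> * deriv \<Psi> z * exp (- \<i> * \<Psi> z) = deriv g z"
    proof -
      have "\<forall>\<^sub>F z in at (complex_of_real x) within {z. 0 < Im z}. z \<in> S \<and> z \<in> {z. 0 < Im z}"
        using eventually_nhds_in_open[OF S(1) xS(1)]
        unfolding eventually_at_filter by (rule eventually_mono) auto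
      then show ?thesis
      proof eventually_elim
        case (elim z)
        then have z: "z \<in> U" "z \<in> S" by (auto simp: U_def S_def)
        have "((\<lambda>z. exp (- \<i> * \<Psi> z)) has_field_derivative exp (- \<i> * \<Psi> z) * (- \<i> * deriv \<Psi> z)) (at z)"
          by (auto intro!: derivative_eq_intros der z)
        moreover have ev: "\<forall>\<^sub>F w in nhds z. exp (- \<i> * \<Psi> w) = g w"
          using eventually_nhds_in_open[OF \<open>open U\<close> z(1)]
          by eventually_elim (auto simp: gL \<Psi>_def U_def T_def)
        ultimately have "(g has_field_derivative exp (- \<i> * \<Psi> z) * (- \<i> * deriv \<Psi> z)) (at z)"
          using DERIV_cong_ev[OF refl ev refl] by blast
        then show ?case by (simp add: DERIV_imp_deriv mult_ac)
      qed
    qed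
    ultimately show ?thesis
      using Lim_transform_eventually by metis
  qed
  \<comment> \<open>Only \<open>g\<close> is periodic; its argument may change by a multiple of
    \<open>2 * pi\<close>. The sign in \<open>D = - n\<close> comes from \<open>g\<close> having the
    argument \<open>- \<psi>\<close>.\<close>
  have "cis (- \<psi> pi) = cis (- \<psi> (- pi))"
    using per[of "-pi"] by (simp flip: gx)
  then have "exp (\<i> * of_real (- \<psi> pi)) = exp (\<i> * of_real (- \<psi> (- pi)))"
    by (simp only: cis_conv_exp)
  then obtain n :: int where "\<i> * of_real (- \<psi> pi) = \<i> * of_real (- \<psi> (- pi)) + (of_int (2 * n) * pi) * \<i>"
    unfolding exp_eq by blast
  then have "- \<psi> pi = - \<psi> (- pi) + 2 * of_int n * pi"
    by (simp add: complex_eq_iff)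
  then have D: "\<psi> pi - \<psi> (- pi) = 2 * pi * of_int (- n)" by (simp add: algebra_simps)
  have "continuous_on UNIV \<psi>'"
    unfolding \<psi>'_def using xS(1) d
    by (intro continuous_intros continuous_on_compose2[OF cont']) auto
  then show ?thesis
    using that[OF der\<psi> _ pos gx lim D] by blast
qed

text \<open>An increasing \<open>f\<close> takes each value \<open>2 * pi * k\<close> with
  \<open>k\<close> in \<open>{1..D}\<close> exactly once. The half-open interval drops the multiple
  \<open>0\<close> at \<open>a\<close> and keeps the one at \<open>b\<close>.\<close>

lemma card_multiples_2pi:
  fixes f :: "real \<Rightarrow> real" and D :: nat
  assumes "a < b" and cont: "continuous_on {a..b} f" and mono: "strict_mono_on {a..b} f"
    and "f a = 0" "f b = 2 * pi * D"
  shows "card {x \<in> {a<..b}. \<exists>k::int. f x = 2 * pi * of_int k} = D"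
proof -
  let ?A = "{x \<in> {a<..b}. \<exists>k::int. f x = 2 * pi * of_int k}"
  have lt: "f x < f y \<longleftrightarrow> x < y" if "x \<in> {a..b}" "y \<in> {a..b}" for x y
    using mono that by (meson strict_mono_on_less)
  have inj: "inj_on f {a..b}" using mono strict_mono_on_imp_inj_on by blast
  have "f ` ?A = (\<lambda>k. 2 * pi * real k) ` {1..D}"
  proof (intro equalityI subsetI)
    fix y assume "y \<in> f ` ?A"
    then obtain x k where x: "x \<in> {a<..b}" "y = f x" "f x = 2 * pi * of_int k" by blast
    have "f x > 0" using lt[of a x] x assms by auto
    then have "k > 0" using x by (simp add: zero_less_mult_iff)
    have "f x \<le> f b" using lt[of b x] x assms by (auto simp: not_less[symmetric])
    then have "k \<le> int D" using x assms(5)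
      by (metis mult_le_cancel_left_pos of_int_le_iff of_int_of_nat_eq pi_gt_zero zero_less_mult_iff zero_less_numeral)
    then show "y \<in> (\<lambda>k. 2 * pi * real k) ` {1..D}"
      using x \<open>k > 0\<close> by (intro image_eqI[of _ _ "nat k"]) auto
  next
    fix y assume "y \<in> (\<lambda>k. 2 * pi * real k) ` {1..D}"
    then obtain k where k: "k \<in> {1..D}" "y = 2 * pi * real k" by blast
    have "\<exists>x\<ge>a. x \<le> b \<and> f x = y"
      using k assms by (intro IVT') auto
    then obtain x where x: "a \<le> x" "x \<le> b" "f x = y" by blast
    have "x \<noteq> a" using x k assms by auto
    then show "y \<in> f ` ?A"
      using x k by (intro image_eqI[of _ _ x]) (auto intro!: exI[of _ "int k"])
  qed
  moreover have "inj_on f ?A" by (rule inj_on_subset[OF inj]) auto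
  moreover have "inj_on (\<lambda>k. 2 * pi * real k) {1..D}" by (auto simp: inj_on_def)
  ultimately have "card ?A = card {1..D}"
    using card_image[of f ?A] card_image[of "\<lambda>k. 2 * pi * real k" "{1..D}"] by simp
  then show ?thesis by simp
qed

section \<open>The banks of the red slot\<close>

lemma open_finite_part:
  assumes "openin sphere_top V"
  shows "open {z. Some z \<in> V}"
proof -
  consider U where "open U" "V = Some ` U"
    | C where "compact C" "V = insert None (Some ` (- C))"
    using assms by (auto simp: sphere_top_def openin_Alexandroff_compactification Compl_eq_Diff_UNIV)
  then show ?thesis
  proof cases
    case 1
    then have "{z. Some z \<in> V} = U" by auto
    then show ?thesis using 1 by simp
  next
    case 2
    then have "{z. Some z \<in> V} = - C" by auto
    then show ?thesis using 2 by (simp add: compact_imp_closed open_Compl)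
  qed
qed

lemma openin_Some_image: "open U \<Longrightarrow> openin sphere_top (Some ` U)"
  by (auto simp: sphere_top_def openin_Alexandroff_compactification)

lemma topspace_surface: "topspace (surface G) = points G"
proof
  show "topspace (surface G) \<subseteq> points G"
    using openin_topspace[of "surface G"] by (simp only: openin_surface surface_open_def)
  have "openin sphere_top (topspace sphere_top)"
    by (rule openin_topspace)
  moreover have "topspace sphere_top = UNIV"
    by (simp add: sphere_top_def UNIV_option_conv)
  ultimately have "surface_open G (points G)"
    unfolding surface_open_def by (intro conjI ballI exI[of _ "topspace sphere_top"]) auto
  then show "points G \<subseteq> topspace (surface G)"
    by (simp add: openin_subset openin_surface)
qed

lemma openin_surface_proj:
  assumes "open U"
  shows "openin (surface G) {q \<in> points G. proj q \<in> Some ` U}"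
  unfolding openin_surface surface_open_def
  using openin_Some_image[OF assms] by blast

section \<open>A strip as parameter domain for the banks of the red slot\<close>

definition slots_apart :: "(nat \<Rightarrow> real) \<Rightarrow> bool" where
  "slots_apart a \<longleftrightarrow> a 1 < a 2 \<and> a 3 < a 4 \<and>
     {-1..1} \<inter> {a 1..a 2} = {} \<and> {-1..1} \<inter> {a 3..a 4} = {}"

text \<open>The strip \<open>0 \<le> Im \<tau>\<close> wraps around the slot \<open>[-1, 1]\<close>: the real interval \<open>[- pi, 0]\<close> runs along its
  upper bank and \<open>[0, pi]\<close> along its lower bank, and \<open>\<tau>\<close> is a local parameter also at \<open>\<plusminus>1\<close>.\<close>

definition slot_pt :: "complex \<Rightarrow> unit point" where
  "slot_pt \<tau> = ((), Im \<tau> = 0 \<longrightarrow> sin (Re \<tau>) \<le> 0, Some (cos \<tau>))"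

definition other_slots :: "(nat \<Rightarrow> real) \<Rightarrow> complex set" where
  "other_slots a = complex_of_real ` ({a 1..a 2} \<union> {a 3..a 4})"

lemma closed_other_slots: "closed (other_slots a)"
  unfolding other_slots_def
  by (intro compact_imp_closed compact_continuous_image continuous_intros compact_Un compact_Icc)

lemma slot_points_eq:
  "slot_points a = Some ` (complex_of_real ` {-1..1} \<union> other_slots a)"
  by (auto simp: slot_points_def slots_def other_slots_def)

lemma open_segment_of_real_less:
  assumes "a < b"
  shows "open_segment (complex_of_real a) (complex_of_real b) = complex_of_real ` {a<..<b}"
  using assms by (simp add: open_segment_of_real open_segment_eq_real_ivl)

lemma Im_cos_eq: "Im (cos \<tau>) = - sin (Re \<tau>) * sinh (Im \<tau>)"
  by (simp add: Im_cos sinh_field_def) (simp add: field_simps)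

lemma Re_cos_eq: "Re (cos \<tau>) = cos (Re \<tau>) * cosh (Im \<tau>)"
  by (simp add: Re_cos cosh_field_def)

text \<open>Above the axis \<open>sinh (Im \<tau>)\<close> is positive, so a real cosine forces
  \<open>sin (Re \<tau>) = 0\<close>; its modulus is then
  \<open>cosh (Im \<tau>) > 1\<close>.\<close>

lemma cos_notin_slot:
  assumes "Im \<tau> > 0"
  shows "cos \<tau> \<notin> complex_of_real ` {-1..1}"
proof
  assume "cos \<tau> \<in> complex_of_real ` {-1..1}"
  then obtain t where t: "cos \<tau> = of_real t" "\<bar>t\<bar> \<le> 1" by auto
  have "sinh (Im \<tau>) > 0" using assms by simp
  moreover have "Im (cos \<tau>) = 0" using t by simp
  ultimately have s: "sin (Re \<tau>) = 0" by (auto simp: Im_cos_eq)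
  have "cosh (Im \<tau>) > 1" using assms cosh_real_strict_mono[of 0 "Im \<tau>"] by simp
  moreover have "\<bar>cos (Re \<tau>)\<bar> = 1" using s sin_zero_abs_cos_one by blast
  moreover have "\<bar>Re (cos \<tau>)\<bar> \<le> 1" using t by simp
  ultimately show False by (simp add: Re_cos_eq abs_mult)
qed

lemma in_points_pants_R:
  assumes "slots_apart a"
  shows "((), d, Some (complex_of_real y)) \<in> points (pants_R a) \<longleftrightarrow>
    d \<or> y \<in> {-1<..<1} \<union> {a 1<..<a 2} \<union> {a 3<..<a 4}"
proof -
  have "complex_of_real y \<in> open_segment (- 1) 1 \<longleftrightarrow> y \<in> {-1<..<1}"
    using open_segment_of_real_less[of "-1" 1] by auto
  moreover have "complex_of_real y \<in> open_segment (complex_of_real (a 1)) (complex_of_real (a 2)) \<longleftrightarrow>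
      y \<in> {a 1<..<a 2}"
    using assms open_segment_of_real_less[of "a 1" "a 2"] by (auto simp: slots_apart_def)
  moreover have "complex_of_real y \<in> open_segment (complex_of_real (a 3)) (complex_of_real (a 4)) \<longleftrightarrow>
      y \<in> {a 3<..<a 4}"
    using assms open_segment_of_real_less[of "a 3" "a 4"] by (auto simp: slots_apart_def)
  ultimately show ?thesis
    by (auto simp: points_def pants_R_def slots_def)
qed

lemma slot_pt_of_real:
  "slot_pt (complex_of_real x) = ((), sin x \<le> 0, Some (complex_of_real (cos x)))"
  by (simp add: slot_pt_def cos_of_real)

lemma cos_interior: "sin (x::real) \<noteq> 0 \<Longrightarrow> -1 < cos x \<and> cos x < 1"
proof -
  assume "sin x \<noteq> 0"
  then have "(cos x)\<^sup>2 < 1" using sin_cos_squared_add[of x] by (smt (verit) zero_less_power2)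
  then show ?thesis by (simp add: abs_square_less_1 abs_less_iff)
qed

lemma slot_pt_in_points:
  assumes "slots_apart a" "Im \<tau> \<ge> 0"
  shows "slot_pt \<tau> \<in> points (pants_R a)"
proof (cases "Im \<tau> = 0")
  case True
  then have \<tau>: "\<tau> = complex_of_real (Re \<tau>)" by (simp add: complex_eq_iff)
  have "sin (Re \<tau>) \<le> 0 \<or> cos (Re \<tau>) \<in> {-1<..<1}"
    using cos_interior[of "Re \<tau>"] by fastforce
  then show ?thesis
    by (subst \<tau>) (simp only: slot_pt_of_real in_points_pants_R[OF assms(1)], blast)
next
  case False
  then show ?thesis by (simp add: slot_pt_def points_def pants_R_def)
qed

lemma slot_pt_real_in_over_slot:
  assumes "slots_apart a"
  shows "slot_pt (complex_of_real x) \<in> over_slot a (-1) 1"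
  using slot_pt_in_points[OF assms, of "complex_of_real x"]
  by (auto simp: over_slot_def proj_def slot_pt_of_real)

lemma slot_pt_notin_over_slot:
  assumes "Im \<tau> > 0"
  shows "slot_pt \<tau> \<notin> over_slot a (-1) 1"
  using cos_notin_slot[OF assms] by (auto simp: over_slot_def proj_def slot_pt_def)

text \<open>One period of the axis runs exactly once around the slot: \<open>- arccos y\<close>
  parametrises the upper bank and \<open>arccos y\<close> the lower one. The ends \<open>1\<close>
  and \<open>-1\<close> are single points, met at \<open>0\<close> and \<open>pi\<close>;
  \<open>- pi\<close> is left out because it repeats \<open>pi\<close>.\<close>

lemma bij_betw_slot_pt:
  assumes a: "slots_apart a"
  shows "bij_betw (\<lambda>x. slot_pt (complex_of_real x)) {-pi<..pi} (over_slot a (-1) 1)"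
  unfolding bij_betw_def
proof
  show "inj_on (\<lambda>x. slot_pt (complex_of_real x)) {-pi<..pi}"
  proof (rule inj_onI)
    fix x y assume xy: "x \<in> {-pi<..pi}" "y \<in> {-pi<..pi}"
      "slot_pt (complex_of_real x) = slot_pt (complex_of_real y)"
    then have c: "cos x = cos y" and s: "(sin x \<le> 0) = (sin y \<le> 0)"
      by (simp_all add: slot_pt_of_real)
    \<comment> \<open>The cosine fixes the sine up to sign, and the bank flag fixes the
      sign.\<close>
    have "\<bar>sin x\<bar> = \<bar>sin y\<bar>"
      using c by (simp add: abs_eq_iff power2_eq_iff[symmetric] sin_squared_eq)
    then have "sin x = sin y" using s by linarith
    then have "\<exists>n::int. x = y + 2 * pi * n" using c sin_cos_eq_iff[of x y] by simp
    then obtain n :: int where n: "x = y + 2 * pi * of_int n" by blast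
    then have "\<bar>2 * pi * of_int n\<bar> < 2 * pi * 1" using xy by auto
    then have "\<bar>real_of_int n\<bar> < 1" unfolding abs_mult
      by (simp add: pi_gt_zero)
    then have "n = 0" by linarith
    then show "x = y" using n by simp
  qed
  show "(\<lambda>x. slot_pt (complex_of_real x)) ` {-pi<..pi} = over_slot a (-1) 1"
  proof
    show "(\<lambda>x. slot_pt (complex_of_real x)) ` {-pi<..pi} \<subseteq> over_slot a (-1) 1"
      using slot_pt_real_in_over_slot[OF a] by blast
    show "over_slot a (-1) 1 \<subseteq> (\<lambda>x. slot_pt (complex_of_real x)) ` {-pi<..pi}"
    proof
      fix q assume q: "q \<in> over_slot a (-1) 1"
      then obtain d y where y: "q = ((), d, Some (complex_of_real y))" "y \<in> {-1..1}"
        by (cases q) (auto simp: over_slot_def proj_def)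
      then have d: "d \<or> y \<in> {-1<..<1}"
        using q a in_points_pants_R[OF a, of d y] by (auto simp: over_slot_def slots_apart_def)
      \<comment> \<open>The end \<open>y = -1\<close> is set apart, since \<open>- arccos y\<close>
        would then be the excluded \<open>- pi\<close>.\<close>
      show "q \<in> (\<lambda>x. slot_pt (complex_of_real x)) ` {-pi<..pi}"
      proof (cases "d \<and> y \<noteq> -1")
        case True
        then have "- arccos y \<in> {-pi<..pi}"
          using y arccos_lbound[of y] arccos_ubound[of y] arccos_lt_bounded[of y]
            arccos_1 by (cases "y = 1") auto
        moreover have "sin (arccos y) \<ge> 0"
          using y arccos_lbound[of y] arccos_ubound[of y] by (intro sin_ge_zero) auto
        ultimately show ?thesis
          using True y by (intro image_eqI[of _ _ "- arccos y"])
            (auto simp: slot_pt_of_real simp flip: of_real_minus)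
      next
        case False
        show ?thesis
        proof (cases "y = -1")
          case True
          then show ?thesis using y d
            by (intro image_eqI[of _ _ pi]) (auto simp: slot_pt_of_real)
        next
          case f: False
          then have "\<not> d" "y \<in> {-1<..<1}" using False d by auto
          then have "sin (arccos y) > 0" "arccos y \<in> {-pi<..pi}"
            using arccos_lt_bounded[of y] by (auto intro!: sin_gt_zero)
          then show ?thesis
            using y \<open>\<not> d\<close> by (intro image_eqI[of _ _ "arccos y"]) (auto simp: slot_pt_of_real)
        qed
      qed
    qed
  qed
qed

text \<open>Only inner points of the slot need care, because a neighbourhood there lies on one bank.
  The sign of \<open>sin (Re \<tau>)\<close> is locally constant at such a point and decides both
  the flag on the axis and the side above it. This amounts to continuity of \<open>slot_pt\<close>
  up to the axis.\<close>

lemma slot_pt_continuous: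
  assumes a: "slots_apart a" and U: "openin (surface (pants_R a)) U"
    and \<tau>0: "slot_pt \<tau>0 \<in> U" "Im \<tau>0 \<ge> 0" "cos \<tau>0 \<notin> other_slots a"
  shows "\<forall>\<^sub>F \<tau> in nhds \<tau>0. Im \<tau> \<ge> 0 \<longrightarrow> slot_pt \<tau> \<in> U"
proof -
  obtain V where V: "openin sphere_top V" "proj (slot_pt \<tau>0) \<in> V"
    "\<And>q'. q' \<in> points (pants_R a) \<Longrightarrow> proj q' \<in> V \<Longrightarrow> adj (pants_R a) (slot_pt \<tau>0) q' \<Longrightarrow> q' \<in> U"
    using U \<tau>0(1) unfolding openin_surface surface_open_def by blast
  have cont: "(f \<longlongrightarrow> f \<tau>0) (nhds \<tau>0)" if "isCont f \<tau>0" for f :: "complex \<Rightarrow> 'b::t2_space"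
    using that by (simp add: isCont_def tendsto_at_iff_tendsto_nhds)
  have "\<forall>\<^sub>F \<tau> in nhds \<tau>0. cos \<tau> \<in> {z. Some z \<in> V}"
    by (rule topological_tendstoD[OF cont open_finite_part[OF V(1)]])
       (use V(2) in \<open>auto simp: slot_pt_def proj_def\<close>)
  moreover have "\<forall>\<^sub>F \<tau> in nhds \<tau>0. Im \<tau> \<ge> 0 \<longrightarrow> adj (pants_R a) (slot_pt \<tau>0) (slot_pt \<tau>)"
  proof -
    have no: "cos \<tau>0 \<notin> open_segment (complex_of_real (a 1)) (complex_of_real (a 2))"
        "cos \<tau>0 \<notin> open_segment (complex_of_real (a 3)) (complex_of_real (a 4))"
      using \<tau>0(3) a open_segment_of_real_less[of "a 1" "a 2"] open_segment_of_real_less[of "a 3" "a 4"]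
      by (auto simp: other_slots_def slots_apart_def)
    have seg: "open_segment (- 1) 1 = complex_of_real ` {-1<..<1}"
      using open_segment_of_real_less[of "-1" 1] by simp
    \<comment> \<open>The pants have no seams or pins and \<open>cos \<tau>0\<close> avoids the
      other slots, so \<open>adj\<close> reduces to the bank condition for
      \<open>[-1, 1]\<close>.\<close>
    have adj: "adj (pants_R a) (slot_pt \<tau>0) (slot_pt \<tau>) \<longleftrightarrow>
       (cos \<tau>0 \<in> open_segment (-1) 1 \<longrightarrow>
         (if cos \<tau> \<in> open_segment (-1) 1
          then (Im \<tau> = 0 \<longrightarrow> sin (Re \<tau>) \<le> 0) = (Im \<tau>0 = 0 \<longrightarrow> sin (Re \<tau>0) \<le> 0)
          else side (-1) 1 (Im \<tau>0 = 0 \<longrightarrow> sin (Re \<tau>0) \<le> 0) (cos \<tau>)))" for \<tau>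
      using no by (simp add: adj_def slot_pt_def on_bank_def pants_R_def slots_def)
    show ?thesis
    proof (cases "cos \<tau>0 \<in> open_segment (-1) 1")
      case False
      then show ?thesis by (simp add: adj)
    next
      case True
      then have im0: "Im \<tau>0 = 0"
        using cos_notin_slot[of \<tau>0] \<tau>0(2) by (force simp: seg)
      have "sin (Re \<tau>0) \<noteq> 0"
      proof
        assume "sin (Re \<tau>0) = 0"
        then have "\<bar>cos (Re \<tau>0)\<bar> = 1" using sin_zero_abs_cos_one by blast
        moreover have "Re (cos \<tau>0) \<in> {-1<..<1}" using True by (auto simp: seg)
        ultimately show False using im0 by (auto simp: Re_cos_eq)
      qed
      moreover have c: "((\<lambda>\<tau>. sin (Re \<tau>)) \<longlongrightarrow> sin (Re \<tau>0)) (nhds \<tau>0)"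
        by (rule cont) (intro isCont_o2[OF isCont_Re] continuous_intros)
      ultimately have "\<forall>\<^sub>F \<tau> in nhds \<tau>0. sgn (sin (Re \<tau>)) = sgn (sin (Re \<tau>0))"
      proof (cases "sin (Re \<tau>0) > 0")
        case True
        then show ?thesis
          using order_tendstoD(1)[OF c True] by (auto elim!: eventually_mono)
      next
        case False
        then have "sin (Re \<tau>0) < 0" using \<open>sin (Re \<tau>0) \<noteq> 0\<close> by simp
        then show ?thesis
          using order_tendstoD(2)[OF c, of 0] by (auto elim!: eventually_mono)
      qed
      then show ?thesis
      proof eventually_elim
        case (elim \<tau>)
        show ?case
        proof
          assume im: "0 \<le> Im \<tau>"
          show "adj (pants_R a) (slot_pt \<tau>0) (slot_pt \<tau>)"
          proof (cases "Im \<tau> = 0")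
            case True
            have "sin (Re \<tau>) \<noteq> 0"
              using elim \<open>sin (Re \<tau>0) \<noteq> 0\<close> by (metis sgn_zero_iff)
            then have "cos (Re \<tau>) \<in> {-1<..<1}" using cos_interior by auto
            moreover have "cos \<tau> = complex_of_real (cos (Re \<tau>))"
              using True by (simp add: complex_eq_iff Re_cos_eq Im_cos_eq)
            ultimately have "cos \<tau> \<in> open_segment (-1) 1" by (auto simp: seg)
            moreover have "(sin (Re \<tau>) \<le> 0) = (sin (Re \<tau>0) \<le> 0)"
              using elim by (auto simp: sgn_real_def split: if_splits)
            ultimately show ?thesis using True im0 by (simp add: adj)
          next
            case False
            then have p: "Im \<tau> > 0" using im by simp
            then have "cos \<tau> \<notin> open_segment (-1) 1"
              using cos_notin_slot[of \<tau>] by (auto simp: seg)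
            moreover have "side (-1) 1 (sin (Re \<tau>0) \<le> 0) (cos \<tau>)"
              using elim p \<open>sin (Re \<tau>0) \<noteq> 0\<close>
              by (auto simp: side_def Im_cos_eq sgn_real_def zero_less_mult_iff mult_less_0_iff
                  split: if_splits)
            ultimately show ?thesis using im0 by (simp add: adj)
          qed
        qed
      qed
    qed
  qed
  ultimately show ?thesis
  proof eventually_elim
    case (elim \<tau>)
    show ?case
      using elim V(3)[of "slot_pt \<tau>"] slot_pt_in_points[OF a, of \<tau>]
      by (auto simp: proj_def slot_pt_def)
  qed
qed

section \<open>The red boundary of the target\<close>

lemma mu_bounds:
  assumes "1 < lam" "lam < 2"
  shows "1 < inverse (mu lam)" "inverse (mu lam) < 2"
proof -
  define q where "q = (3 - lam) / (2 * lam)"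
  have q: "1/4 < q" "q < 1" using assms by (auto simp: q_def field_simps)
  have m: "mu lam = sqrt q" by (simp add: mu_def q_def)
  have "sqrt (1/4) < sqrt q" "sqrt q < sqrt 1" using q by (simp_all only: real_sqrt_less_iff)
  then have "1/2 < mu lam" "mu lam < 1" by (auto simp: m real_sqrt_divide)
  then show "1 < inverse (mu lam)" "inverse (mu lam) < 2"
    by (simp_all add: field_simps)
qed

lemma eps_eq: "eps = Complex (- 1/2) (sqrt 3 / 2)" "eps\<^sup>2 = Complex (- 1/2) (- sqrt 3 / 2)"
proof -
  have "2 * pi / 3 = pi - pi / 3" by simp
  then show e: "eps = Complex (- 1/2) (sqrt 3 / 2)"
    unfolding eps_def
    by (simp only: complex_eq_iff cis.sel cos_diff sin_diff) (simp add: cos_60 sin_60)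
  show "eps\<^sup>2 = Complex (- 1/2) (- sqrt 3 / 2)"
    by (simp add: e power2_eq_square complex_eq_iff)
qed

lemma Im_div_eps:
  "Im (p / eps) = - (sqrt 3 * Re p + Im p) / 2"
  "Im (p / eps\<^sup>2) = (sqrt 3 * Re p - Im p) / 2"
  by (simp_all only: eps_eq) (simp_all add: Im_divide power2_eq_square field_simps)

text \<open>The lines through \<open>0\<close> in the directions of \<open>eps\<close> and its square have distance
  \<open>sqrt 3 / 2\<close> times \<open>inverse (mu lam)\<close> from the centre of the circle, which exceeds its radius.\<close>

lemma circle_C_off_lines:
  assumes lam: "1 < lam" "lam < 2" and p: "p \<in> circle_C lam" and e: "e \<in> {eps, eps\<^sup>2}"
  shows "Im (p / e) * Im (complex_of_real (inverse (mu lam)) / e) > 0"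
proof -
  define m where "m = inverse (mu lam)"
  have m: "1 < m" "m < 2" using mu_bounds[OF lam] by (auto simp: m_def)
  define x y where "x = Re p - m" and "y = Im p"
  have xy: "x\<^sup>2 + y\<^sup>2 = m\<^sup>2 - 1"
    using p unfolding circle_C_def m_def[symmetric] by (simp add: cmod_power2 x_def y_def)
  have *: "sqrt 3 * (m + x) + t > 0" if t: "t\<^sup>2 = y\<^sup>2" for t
  proof -
    \<comment> \<open>An explicit form of the Cauchy-Schwarz inequality: the two squares add up to
      four times the squared radius. The strict bound that follows,
      \<open>4 * (m\<^sup>2 - 1) < 3 * m\<^sup>2\<close>, is \<open>m < 2\<close>.\<close>
    have "(sqrt 3 * x + t)\<^sup>2 + (x - sqrt 3 * t)\<^sup>2 = 4 * (m\<^sup>2 - 1)"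
      using xy t by (simp add: power2_eq_square algebra_simps)
    then have "(sqrt 3 * x + t)\<^sup>2 \<le> 4 * (m\<^sup>2 - 1)"
      by (smt (verit) zero_le_power2)
    also have "\<dots> < (sqrt 3 * m)\<^sup>2"
      using m power_strict_mono[of m 2 2] by (simp add: power_mult_distrib)
    finally have lt: "(sqrt 3 * x + t)\<^sup>2 < (sqrt 3 * m)\<^sup>2" .
    have "\<bar>sqrt 3 * x + t\<bar> < \<bar>sqrt 3 * m\<bar>"
      using lt abs_le_square_iff[of "sqrt 3 * m" "sqrt 3 * x + t"] by linarith
    then have "\<bar>sqrt 3 * x + t\<bar> < sqrt 3 * m"
      using m by (simp only: abs_mult) simp
    then show ?thesis by (simp add: algebra_simps abs_less_iff)
  qed
  have "sqrt 3 * Re p + Im p > 0" "sqrt 3 * Re p - Im p > 0"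
    using *[of y] *[of "-y"] by (simp_all add: x_def y_def)
  then show ?thesis
    using e m(1) by (auto simp: Im_div_eps m_def[symmetric] mult_less_0_iff zero_less_mult_iff)
qed

lemma circle_C_subset_annulus:
  assumes "1 < lam" "lam < 2" "p \<in> circle_C lam" "e \<in> {eps, eps\<^sup>2}"
  shows "Some p \<in> annulus lam e"
  using circle_C_off_lines[OF assms] assms(3) by (auto simp: annulus_def circle_C_def)

text \<open>From a point of the circle a short step towards the centre leaves the annulus. Hence the
  branch point \<open>h\<close> of the first fashion, which is deleted from one of its two sheets,
  is not on the circle.\<close>

lemma circle_C_not_interior_annulus:
  assumes lam: "1 < lam" "lam < 2" and h: "Some h \<in> sphere_top interior_of (annulus lam e \<inter> X)"
  shows "h \<notin> circle_C lam"
proof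
  assume C: "h \<in> circle_C lam"
  define m where "m = complex_of_real (inverse (mu lam))"
  obtain T where T: "openin sphere_top T" "Some h \<in> T" "T \<subseteq> annulus lam e"
    using h by (auto simp: interior_of_def)
  have "((\<lambda>t. h + of_real t * (m - h)) \<longlongrightarrow> h + of_real 0 * (m - h)) (at_right 0)"
    by (intro tendsto_intros)
  then have "\<forall>\<^sub>F t in at_right 0. h + of_real t * (m - h) \<in> {z. Some z \<in> T}"
    by (rule topological_tendstoD[OF _ open_finite_part[OF T(1)]]) (use T(2) in simp)
  then have "\<forall>\<^sub>F t::real in at_right 0. False"
    using eventually_at_right_real[of 0 1, OF zero_less_one]
  proof eventually_elim
    case (elim t)
    have "Some (h + of_real t * (m - h)) \<in> annulus lam e" using elim T(3) by auto
    then have "(inverse (mu lam))\<^sup>2 - 1 \<le> (cmod (h + of_real t * (m - h) - m))\<^sup>2"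
      by (auto simp: annulus_def m_def)
    also have "h + of_real t * (m - h) - m = of_real (1 - t) * (h - m)"
      by (simp add: algebra_simps)
    also have "(cmod (of_real (1 - t) * (h - m)))\<^sup>2 = (1 - t)\<^sup>2 * (cmod (h - m))\<^sup>2"
      by (simp only: norm_mult power_mult_distrib norm_of_real power2_abs)
    also have "(cmod (h - m))\<^sup>2 = (inverse (mu lam))\<^sup>2 - 1"
      using C by (simp add: circle_C_def m_def)
    finally have "(inverse (mu lam))\<^sup>2 - 1 \<le> (1 - t)\<^sup>2 * ((inverse (mu lam))\<^sup>2 - 1)" .
    moreover have "(inverse (mu lam))\<^sup>2 - 1 > 0"
      using mu_bounds[OF lam] one_less_power[of "inverse (mu lam)" 2] by simp
    moreover have "(1 - t)\<^sup>2 < 1" using elim by (simp add: abs_square_less_1 abs_less_iff)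
    ultimately show False
      by (smt (verit) mult_less_cancel_right2)
  qed
  then show False by (simp add: eventually_False trivial_limit_at_right_real)
qed

section \<open>Points of the target over the red circle\<close>

lemma pants_region_outside_circle:
  assumes "q \<in> points (pants s lam h1 h2 m1 m2 g0 g1 g2)" "proj q = Some w"
  shows "(cmod (w - complex_of_real (inverse (mu lam))))\<^sup>2 \<ge> (inverse (mu lam))\<^sup>2 - 1"
  using assms
  by (auto simp: points_def proj_def pants_def pants1_def pants_slit_def Let_def annulus_def
      split: if_splits sheet.splits)

text \<open>The slit lies on the line through \<open>0\<close> in the direction of \<open>e\<close>,
  which misses the circle. So a point of the circle is not doubled into two banks on the slit
  sheet.\<close>

lemma circle_C_off_slit:
  assumes lam: "1 < lam" "lam < 2" and w: "w \<in> circle_C lam" and e: "e \<in> {eps, eps\<^sup>2}"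
  shows "w \<notin> open_segment (fst (slit_ends e h1 h2)) (snd (slit_ends e h1 h2))"
proof
  assume "w \<in> open_segment (fst (slit_ends e h1 h2)) (snd (slit_ends e h1 h2))"
  then obtain u where "w = (1 - u) *\<^sub>R (- e * of_real h1) + u *\<^sub>R (- e * of_real h2)"
    by (auto simp: in_segment slit_ends_def)
  then have "w = e * of_real (- (1 - u) * h1 - u * h2)"
    by (simp add: scaleR_conv_of_real algebra_simps)
  moreover have "e \<noteq> 0" using e by (auto simp: eps_def)
  ultimately have "Im (w / e) = 0" by (simp del: of_real_mult of_real_diff)
  then show False using circle_C_off_lines[OF lam w e] by simp
qed

text \<open>There are \<open>m1 + 1\<close> sheets over one annulus and \<open>m2 + 1\<close> over
  the other. A seam ending at \<open>w\<close> does not change the count, since each sheet still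
  stores exactly one point over \<open>w\<close>.\<close>

lemma card_fibre_pants1:
  assumes lam: "1 < lam" "lam < 2" and cuts: "cuts1 lam h g0 g1 g2" and w: "w \<in> circle_C lam"
  shows "card {q \<in> points (pants1 lam h m1 m2 g0 g1 g2). proj q = Some w} = m1 + m2 + 2"
proof -
  have "w \<noteq> h" using circle_C_not_interior_annulus[OF lam] cuts w by (auto simp: cuts1_def)
  then have "{q \<in> points (pants1 lam h m1 m2 g0 g1 g2). proj q = Some w} =
      (\<lambda>k. (k, True, Some w)) ` (Alpha ` {..m1} \<union> AlphaBar ` {..m2})"
    using circle_C_subset_annulus[OF lam w, of eps] circle_C_subset_annulus[OF lam w, of "eps\<^sup>2"]
    by (auto simp: points_def proj_def pants1_def split: if_splits sheet.splits)
  also have "card \<dots> = card (Alpha ` {..m1} \<union> AlphaBar ` {..m2})"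
    by (rule card_image) (auto simp: inj_on_def)
  also have "\<dots> = card (Alpha ` {..m1}) + card (AlphaBar ` {..m2})"
    by (rule card_Un_disjoint) auto
  also have "\<dots> = m1 + m2 + 2"
    by (simp add: card_image inj_on_def)
  finally show ?thesis .
qed

text \<open>The second cycle of sheets starts with \<open>main 0\<close> itself, so only
  \<open>n'\<close> new sheets join the \<open>n + 1\<close> copies \<open>main i\<close>.\<close>

lemma card_fibre_pants_slit:
  assumes lam: "1 < lam" "lam < 2" and w: "w \<in> circle_C lam"
    and e: "e \<in> {eps, eps\<^sup>2}" "f \<in> {eps, eps\<^sup>2}"
    and inj: "inj main" "inj other" "range main \<inter> range other = {}"
  shows "card {q \<in> points (pants_slit main other lam e f h1 h2 n n' g g'). proj q = Some w} = n + n' + 1"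
proof -
  obtain A B where AB: "slit_ends f h1 h2 = (A, B)" by (cases "slit_ends f h1 h2")
  have "{q \<in> points (pants_slit main other lam e f h1 h2 n n' g g'). proj q = Some w} =
      (\<lambda>k. (k, True, Some w)) ` (main ` {0..n} \<union> other ` {1..n'})"
    using circle_C_subset_annulus[OF lam w e(1)] circle_C_subset_annulus[OF lam w e(2)]
      circle_C_off_slit[OF lam w e(2), of h1 h2]
    by (auto simp: points_def proj_def pants_slit_def Let_def AB split: if_splits)
  also have "card \<dots> = card (main ` {0..n} \<union> other ` {1..n'})"
    by (rule card_image) (auto simp: inj_on_def)
  also have "\<dots> = card (main ` {0..n}) + card (other ` {1..n'})"
    by (rule card_Un_disjoint) (use inj(3) in auto)
  also have "\<dots> = n + n' + 1"
    using inj by (simp add: card_image inj_on_subset)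
  finally show ?thesis .
qed

lemma card_fibre_pants:
  assumes lam: "1 < lam" "lam < 2" and s: "s \<in> {1, 2, 3}"
    and cuts: "admissible_cuts s lam h1 h2 g0 g1 g2" and w: "w \<in> circle_C lam"
  shows "card {q \<in> points (pants s lam h1 h2 m1 m2 g0 g1 g2). proj q = Some w} =
    (if s = 1 then m1 + m2 + 2 else m1 + m2 + 1)"
proof -
  have inj: "inj Alpha" "inj AlphaBar" "range Alpha \<inter> range AlphaBar = {}"
    "range AlphaBar \<inter> range Alpha = {}" by (auto simp: inj_on_def)
  consider "s = 1" | "s = 2" | "s = 3" using s by blast
  then show ?thesis
  proof cases
    case 1
    with cuts have "cuts1 lam (Complex h1 h2) g0 g1 g2" by (simp add: admissible_cuts_def)
    from card_fibre_pants1[OF lam this w] 1 show ?thesis by (simp add: pants_def)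
  next
    case 2
    have "card {q \<in> points (pants_slit Alpha AlphaBar lam eps (eps\<^sup>2) h1 h2 m1 m2 g1 g2).
        proj q = Some w} = m1 + m2 + 1"
      by (intro card_fibre_pants_slit[OF lam w _ _ inj(1,2,3)]) blast+
    with 2 show ?thesis by (simp add: pants_def)
  next
    case 3
    have "card {q \<in> points (pants_slit AlphaBar Alpha lam (eps\<^sup>2) eps h1 h2 m2 m1 g2 g1).
        proj q = Some w} = m2 + m1 + 1"
      by (intro card_fibre_pants_slit[OF lam w _ _ inj(2,1,4)]) blast+
    with 3 show ?thesis by (simp add: pants_def)
  qed
qed

section \<open>Boundary values of the conformal map\<close>

lemma cis_eq_cis_iff: "cis x = cis y \<longleftrightarrow> (\<exists>k::int. x - y = 2 * pi * of_int k)"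
proof -
  have "cis x = cis y \<longleftrightarrow> sin x = sin y \<and> cos x = cos y"
    by (auto simp: complex_eq_iff)
  also have "\<dots> \<longleftrightarrow> (\<exists>k::int. x - y = 2 * pi * of_int k)"
    unfolding sin_cos_eq_iff by (auto simp: algebra_simps)
  finally show ?thesis .
qed

lemma slot_pt_periodic: "slot_pt (\<tau> + complex_of_real (2 * pi * of_int n)) = slot_pt \<tau>"
proof -
  have "cos (\<tau> + complex_of_real t) = cos \<tau> * of_real (cos t) - sin \<tau> * of_real (sin t)" for t
    by (simp add: cos_add cos_of_real sin_of_real)
  from this[of "2 * pi * of_int n"] have "cos (\<tau> + complex_of_real (2 * pi * of_int n)) = cos \<tau>"
    by (simp only: cos_int_2pin sin_int_2pin of_real_0 of_real_1 mult_zero_right mult_1_right diff_zero)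
  moreover have "sin (Re \<tau> + 2 * pi * of_int n) = sin (Re \<tau>)"
    by (simp only: sin_add cos_int_2pin sin_int_2pin mult_zero_right mult_1_right add_0_right)
  ultimately show ?thesis by (simp only: slot_pt_def plus_complex.sel Re_complex_of_real Im_complex_of_real add_0_right)
qed

text \<open>At a finite point with a finite value both charts are translations, so the analyticity
  in \<open>conformal_pants_map\<close> gives ordinary differentiability of
  \<open>pfun F\<close>.\<close>

lemma pfun_field_differentiable:
  assumes F: "conformal_pants_map a s lam h1 h2 G F"
    and z: "Some z \<notin> slot_points a" "proj (F ((), True, Some z)) = Some c"
  shows "pfun F field_differentiable at z"
proof -
  have "(\<lambda>t. chart (proj (F ((), True, Some z))) (proj (F ((), True, chart_inv (Some z) t)))) analytic_on {0}"
    using F z(1) by (simp add: conformal_pants_map_def)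
  then have "(\<lambda>t. pfun F (z + t) - c) analytic_on {0}"
    by (simp add: z(2) chart_def chart_inv_def pfun_def)
  then have "(\<lambda>t. pfun F (z + t) - c) field_differentiable at 0"
    using analytic_on_imp_differentiable_at by blast
  then obtain D where D: "((\<lambda>t. pfun F (z + t) - c) has_field_derivative D) (at 0)"
    by (auto simp: field_differentiable_def)
  have "((\<lambda>t. pfun F (t + z)) has_field_derivative D) (at 0)"
    using DERIV_add[OF D DERIV_const[of c]] by (simp add: add.commute)
  then have "(pfun F has_field_derivative D) (at (0 + z))"
    by (simp only: DERIV_shift)
  then show ?thesis by (auto simp: field_differentiable_def)
qed

text \<open>The branch of \<open>arccos\<close> that follows the normal to the bank of \<open>[-1, 1]\<close> at \<open>cos x\<close>.\<close>

lemma arccos_normal: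
  assumes x: "-pi < x" "x < pi" "x \<noteq> 0"
  defines "z \<equiv> \<lambda>t. Complex (cos x) (if x < 0 then t else - t)"
  obtains \<tau> where "\<And>t. cos (\<tau> t) = z t" "\<And>t. t > 0 \<Longrightarrow> Im (\<tau> t) > 0"
    "filterlim \<tau> (at (complex_of_real x) within {z. Im z > 0}) (at_right 0)"
proof -
  \<comment> \<open>\<open>Arccos\<close> takes values with real part between \<open>0\<close> and
    \<open>pi\<close>. For \<open>x < 0\<close> the sign change moves the limit from
    \<open>- x\<close> to \<open>x\<close> and, as \<open>z t\<close> then lies above the slot, also
    makes the imaginary part positive.\<close>
  define \<sigma> :: real where "\<sigma> = (if x < 0 then -1 else 1)"
  define \<tau> where "\<tau> = (\<lambda>t. complex_of_real \<sigma> * Arccos (z t))"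
  have \<sigma>: "\<sigma> = 1 \<or> \<sigma> = -1" by (auto simp: \<sigma>_def)
  have "0 < \<bar>x\<bar>" "\<bar>x\<bar> < pi" using x by auto
  then have "sin \<bar>x\<bar> > 0" by (intro sin_gt_zero)
  then have "sin x \<noteq> 0" by (auto simp: abs_if split: if_splits)
  then have cx: "\<bar>cos x\<bar> < 1" using cos_interior[of x] by auto
  have cos\<tau>: "cos (\<tau> t) = z t" for t
    using \<sigma> by (auto simp: \<tau>_def)
  have Im\<tau>: "Im (\<tau> t) > 0" if "t > 0" for t
  proof -
    have "Re (z t) = cos x" "Im (z t) = - \<sigma> * t" by (auto simp: z_def \<sigma>_def)
    moreover have A: "0 < Re (Arccos (z t))" "Re (Arccos (z t)) < pi"
      using Arccos_bounds[of "z t"] cx by (auto simp: z_def)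
    then have "sin (Re (Arccos (z t))) > 0" by (intro sin_gt_zero)
    ultimately have "sin (Re (Arccos (z t))) * sinh (\<sigma> * Im (Arccos (z t))) = t"
      using Im_cos_eq[of "Arccos (z t)"] \<sigma> by auto
    then have "sinh (\<sigma> * Im (Arccos (z t))) > 0"
      using that \<open>sin (Re (Arccos (z t))) > 0\<close> zero_less_mult_pos by metis
    then show ?thesis by (simp add: \<tau>_def)
  qed
  have "(z \<longlongrightarrow> z 0) (at_right 0)"
    unfolding z_def by (cases "x < 0") (auto intro!: tendsto_eq_intros)
  then have "(\<tau> \<longlongrightarrow> complex_of_real \<sigma> * Arccos (z 0)) (at_right 0)"
    unfolding \<tau>_def using cx
    by (intro tendsto_intros isCont_tendsto_compose[OF isCont_Arccos]) (auto simp: z_def)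
  moreover have "complex_of_real \<sigma> * Arccos (z 0) = complex_of_real x"
  proof -
    have "z 0 = complex_of_real (cos x)" by (simp add: z_def complex_eq_iff)
    then have "Arccos (z 0) = complex_of_real (arccos (cos x))"
      using of_real_arccos[of "cos x"] cx by simp
    also have "arccos (cos x) = \<bar>x\<bar>"
      using x arccos_cos[of "\<bar>x\<bar>"] by simp
    finally show ?thesis by (auto simp: \<sigma>_def)
  qed
  ultimately have "(\<tau> \<longlongrightarrow> complex_of_real x) (at_right 0)" by simp
  moreover have "\<forall>\<^sub>F t in at_right 0. \<tau> t \<in> {z. Im z > 0} \<and> \<tau> t \<noteq> complex_of_real x"
    using eventually_at_right_less[of "0::real"] by eventually_elim (use Im\<tau> in force)
  ultimately have "filterlim \<tau> (at (complex_of_real x) within {z. Im z > 0}) (at_right 0)"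
    by (simp add: filterlim_at)
  with that[OF cos\<tau> Im\<tau>] show ?thesis by blast
qed

text \<open>In the coordinate \<open>\<tau>\<close> the map becomes \<open>g = (p - m) / r\<close>,
  to which \<open>boundary_argument\<close> applies. The integer of that lemma is then identified
  with \<open>d\<close>: \<open>F\<close> maps the red slot bijectively onto the red boundary, so
  the parameters of one period with a given value of \<open>p\<close> correspond to the fibre over
  this value.\<close>

lemma slot_boundary_values:
  fixes m :: real
  assumes a: "slots_apart a"
    and F: "conformal_pants_map a s lam h1 h2 G F"
    and m: "m = inverse (mu lam)" "m > 1" and r: "r = sqrt (m\<^sup>2 - 1)"
    and outside: "\<And>q w. q \<in> points G \<Longrightarrow> proj q = Some w \<Longrightarrow> (cmod (w - of_real m))\<^sup>2 \<ge> m\<^sup>2 - 1"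
    and fibre: "\<And>w. w \<in> circle_C lam \<Longrightarrow> card {q \<in> points G. proj q = Some w} = d"
  obtains \<psi> \<psi>' :: "real \<Rightarrow> real"
  where "\<And>x. (\<psi> has_real_derivative \<psi>' x) (at x)" "continuous_on UNIV \<psi>'" "\<And>x. \<psi>' x > 0"
    "\<And>x. proj (F (slot_pt (complex_of_real x))) = Some (of_real m + of_real r * cis (- \<psi> x))"
    "\<And>x. -pi < x \<Longrightarrow> x < pi \<Longrightarrow> x \<noteq> 0 \<Longrightarrow>
      ((\<lambda>t. deriv (pfun F) (Complex (cos x) (if x < 0 then t else - t))) \<longlongrightarrow>
        \<i> * of_real (r * \<psi>' x / sin x) * cis (- \<psi> x)) (at_right 0)"
    "\<And>x. -pi < x \<Longrightarrow> x < pi \<Longrightarrow> x \<noteq> 0 \<Longrightarrow>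
      \<forall>\<^sub>F t in at_right 0. pfun F field_differentiable at (Complex (cos x) (if x < 0 then t else - t))"
    "\<psi> pi - \<psi> (- pi) = 2 * pi * real d"
proof -
  have r0: "r > 0" "r\<^sup>2 = m\<^sup>2 - 1"
    using m(2) one_less_power[of m 2] by (auto simp: r)
  have hom: "homeomorphic_map (surface (pants_R a)) (surface G) F"
    and red: "F ` over_slot a (-1) 1 = pants_colour s lam h1 h2 G Red"
    using F unfolding conformal_pants_map_def pants_R_colour_def by force+
  have inj: "inj_on F (points (pants_R a))"
    using homeomorphic_imp_injective_map[OF hom] by (simp add: topspace_surface)
  have surj: "F ` points (pants_R a) = points G"
    using homeomorphic_imp_surjective_map[OF hom] by (simp add: topspace_surface)
  have cont: "continuous_map (surface (pants_R a)) (surface G) F"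
    using hom by (rule homeomorphic_imp_continuous_map)
  have circle: "w \<in> circle_C lam \<longleftrightarrow> cmod (w - of_real m) = r" for w
  proof -
    have "w \<in> circle_C lam \<longleftrightarrow> (cmod (w - of_real m))\<^sup>2 = r\<^sup>2"
      by (simp add: circle_C_def m r0(2))
    also have "\<dots> \<longleftrightarrow> cmod (w - of_real m) = r"
      using r0(1) by (intro power2_eq_iff_nonneg) auto
    finally show ?thesis .
  qed
  have red_iff: "q \<in> pants_colour s lam h1 h2 G Red \<longleftrightarrow> q \<in> points G \<and> proj q \<in> Some ` circle_C lam" for q
    by (cases q) (auto simp: pants_colour_def proj_def)
  have over: "over_slot a (-1) 1 \<subseteq> points (pants_R a)" by (auto simp: over_slot_def)
  define P where "P = (\<lambda>\<tau>. proj (F (slot_pt \<tau>)))"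
  \<comment> \<open>Continuity of \<open>P\<close> at finite values, up to the axis, obtained by
    pulling open sets back through \<open>F\<close> and \<open>slot_pt\<close>.\<close>
  have near: "\<forall>\<^sub>F \<tau> in nhds \<tau>0. Im \<tau> \<ge> 0 \<longrightarrow> P \<tau> \<in> Some ` U"
    if "open U" "P \<tau>0 \<in> Some ` U" "Im \<tau>0 \<ge> 0" "cos \<tau>0 \<notin> other_slots a" for U \<tau>0
  proof -
    define V where "V = {q \<in> points (pants_R a). F q \<in> {q \<in> points G. proj q \<in> Some ` U}}"
    have "openin (surface (pants_R a)) V"
      using openin_continuous_map_preimage[OF cont openin_surface_proj[OF that(1)]]
      by (simp add: V_def topspace_surface)
    moreover have "slot_pt \<tau>0 \<in> V"
      using that slot_pt_in_points[OF a, of \<tau>0] surj by (auto simp: V_def P_def)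
    ultimately have "\<forall>\<^sub>F \<tau> in nhds \<tau>0. Im \<tau> \<ge> 0 \<longrightarrow> slot_pt \<tau> \<in> V"
      using slot_pt_continuous[OF a] that by blast
    then show ?thesis by eventually_elim (auto simp: V_def P_def)
  qed
  have Preal: "P (complex_of_real x) \<in> Some ` circle_C lam" for x
    using imageI[OF slot_pt_real_in_over_slot[OF a, of x], of F] unfolding red red_iff P_def by blast
  have cosreal: "cos (complex_of_real x) \<notin> other_slots a" for x
  proof -
    have "cos x \<in> {-1..1}" by simp
    then have "cos x \<notin> {a 1..a 2} \<union> {a 3..a 4}" using a unfolding slots_apart_def by blast
    then show ?thesis by (auto simp: other_slots_def cos_of_real)
  qed
  \<comment> \<open>Excluded are the preimages of the other slots, where \<open>p\<close> is not
    known to be holomorphic, and the parameters where \<open>p\<close> is infinite.\<close>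
  define good where "good = (\<lambda>\<tau>. cos \<tau> \<notin> other_slots a \<and> P \<tau> \<noteq> None)"
  have good_near: "\<forall>\<^sub>F \<tau> in nhds (complex_of_real x). Im \<tau> \<ge> 0 \<longrightarrow> good \<tau>" for x
  proof -
    have "isCont cos (complex_of_real x)" by (rule isCont_cos)
    then have "\<forall>\<^sub>F \<tau> in nhds (complex_of_real x). cos \<tau> \<in> - other_slots a"
      using closed_other_slots[of a] cosreal[of x]
      by (intro topological_tendstoD) (auto simp: isCont_def tendsto_at_iff_tendsto_nhds)
    moreover have "\<forall>\<^sub>F \<tau> in nhds (complex_of_real x). Im \<tau> \<ge> 0 \<longrightarrow> P \<tau> \<in> Some ` UNIV"
      using Preal[of x] cosreal[of x] by (intro near) auto
    ultimately show ?thesis by eventually_elim (auto simp: good_def)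
  qed
  have Pper: "P (\<tau> + complex_of_real (2 * pi * of_int n)) = P \<tau>" for \<tau> n
    by (simp only: P_def slot_pt_periodic)
  have good_per: "good (\<tau> + complex_of_real (2 * pi * of_int n)) \<longleftrightarrow> good \<tau>" for \<tau> n
  proof -
    have "cos (\<tau> + complex_of_real (2 * pi * of_int n)) = cos \<tau>"
      using slot_pt_periodic[of \<tau> n] by (simp only: slot_pt_def prod.inject option.inject)
    then show ?thesis by (simp only: good_def Pper)
  qed
  \<comment> \<open>A Lebesgue number for the compact interval \<open>[0, 2 * pi]\<close> makes
    \<open>good_near\<close> uniform, and periodicity extends the result to a whole strip.\<close>
  obtain \<delta> where \<delta>: "\<delta> > 0" "\<And>\<tau>. 0 \<le> Im \<tau> \<Longrightarrow> Im \<tau> < \<delta> \<Longrightarrow> good \<tau>"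
  proof -
    define \<G> where "\<G> = {U. open U \<and> (\<forall>\<tau>\<in>U. Im \<tau> \<ge> 0 \<longrightarrow> good \<tau>)}"
    have "compact (complex_of_real ` {0..2*pi})"
      by (intro compact_continuous_image continuous_intros compact_Icc)
    moreover have "complex_of_real ` {0..2*pi} \<subseteq> \<Union>\<G>"
      using good_near unfolding eventually_nhds \<G>_def by fast
    ultimately obtain e where e: "e > 0" "\<And>x. x \<in> complex_of_real ` {0..2*pi} \<Longrightarrow> \<exists>U\<in>\<G>. ball x e \<subseteq> U"
      by (rule Heine_Borel_lemma) (auto simp: \<G>_def)
    have "good \<tau>" if \<tau>: "0 \<le> Im \<tau>" "Im \<tau> < e" for \<tau>
    proof -
      define n where "n = \<lfloor>Re \<tau> / (2 * pi)\<rfloor>"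
      define \<tau>' where "\<tau>' = \<tau> + complex_of_real (2 * pi * of_int (- n))"
      have "of_int n \<le> Re \<tau> / (2 * pi)" "Re \<tau> / (2 * pi) \<le> of_int n + 1"
        unfolding n_def by linarith+
      then have "Re \<tau>' \<in> {0..2*pi}"
        by (simp add: \<tau>'_def field_simps)
      then obtain U where U: "U \<in> \<G>" "ball (complex_of_real (Re \<tau>')) e \<subseteq> U" using e(2) by blast
      have "complex_of_real (Re \<tau>') - \<tau>' = \<i> * of_real (- Im \<tau>')"
        by (simp add: complex_eq_iff)
      then have "cmod (complex_of_real (Re \<tau>') - \<tau>') = \<bar>Im \<tau>'\<bar>"
        by (simp add: norm_mult del: of_real_minus)
      then have "\<tau>' \<in> U" using U(2) \<tau> by (auto simp: dist_norm \<tau>'_def)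
      then have "good \<tau>'" using U(1) \<tau> by (auto simp: \<G>_def \<tau>'_def)
      then show ?thesis unfolding \<tau>'_def good_per .
    qed
    with e(1) that show ?thesis by blast
  qed
  define g where "g = (\<lambda>\<tau>. (the (P \<tau>) - of_real m) / of_real r)"
  have P_g: "P \<tau> = Some (of_real m + of_real r * g \<tau>)" if "good \<tau>" for \<tau>
    using that r0(1) by (auto simp: good_def g_def)
  have goodreal: "good (complex_of_real x)" for x using \<delta> by simp
  have cont_g: "continuous_on {z. 0 \<le> Im z \<and> Im z < \<delta>} g"
  proof -
    have "((\<lambda>\<tau>. the (P \<tau>)) \<longlongrightarrow> the (P \<tau>0)) (at \<tau>0 within {z. 0 \<le> Im z \<and> Im z < \<delta>})"
      if \<tau>0: "0 \<le> Im \<tau>0" "Im \<tau>0 < \<delta>" for \<tau>0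
    proof (rule topological_tendstoI)
      fix U assume U: "open U" "the (P \<tau>0) \<in> U"
      have "P \<tau>0 \<in> Some ` U" "cos \<tau>0 \<notin> other_slots a"
        using \<delta>(2)[of \<tau>0] \<tau>0 U(2) by (auto simp: good_def)
      from near[OF U(1) this(1) \<tau>0(1) this(2)]
      show "\<forall>\<^sub>F \<tau> in at \<tau>0 within {z. 0 \<le> Im z \<and> Im z < \<delta>}. the (P \<tau>) \<in> U"
        unfolding eventually_at_filter by eventually_elim auto
    qed
    then show ?thesis
      unfolding g_def continuous_on_def using r0(1) by (auto intro!: tendsto_intros)
  qed
  have P_pfun: "pfun F (cos \<tau>) = the (P \<tau>)" if "Im \<tau> > 0" for \<tau>
    using that by (simp add: P_def pfun_def slot_pt_def)
  have diff_pfun: "pfun F field_differentiable at (cos \<tau>)" if "0 < Im \<tau>" "Im \<tau> < \<delta>" for \<tau>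
  proof (rule pfun_field_differentiable[OF F])
    show "Some (cos \<tau>) \<notin> slot_points a"
      using cos_notin_slot[of \<tau>] \<delta>(2)[of \<tau>] that
      by (simp add: slot_points_eq good_def inj_image_mem_iff)
    show "proj (F ((), True, Some (cos \<tau>))) = Some (the (P \<tau>))"
      using \<delta>(2)[of \<tau>] that by (simp add: good_def P_def slot_pt_def)
  qed
  have der_g: "(g has_field_derivative deriv (pfun F) (cos \<tau>) * (- sin \<tau>) / of_real r) (at \<tau>)"
    if \<tau>: "0 < Im \<tau>" "Im \<tau> < \<delta>" for \<tau>
  proof -
    have "(pfun F has_field_derivative deriv (pfun F) (cos \<tau>)) (at (cos \<tau>))"
      using diff_pfun[OF \<tau>] by (simp add: field_differentiable_derivI)
    from DERIV_chain2[where g=cos and x=\<tau>, OF this DERIV_cos]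
    have c: "((\<lambda>\<tau>. pfun F (cos \<tau>)) has_field_derivative deriv (pfun F) (cos \<tau>) * (- sin \<tau>)) (at \<tau>)" .
    have "((\<lambda>\<tau>. (pfun F (cos \<tau>) - of_real m) / of_real r) has_field_derivative
        deriv (pfun F) (cos \<tau>) * (- sin \<tau>) / of_real r) (at \<tau>)"
      by (rule DERIV_cdivide, rule DERIV_cong[OF DERIV_diff[OF c DERIV_const]]) simp
    moreover have "\<forall>\<^sub>F w in nhds \<tau>. w \<in> {z. Im z > 0}"
      using \<tau> by (intro eventually_nhds_in_open open_halfspace_Im_gt) simp
    then have ev: "\<forall>\<^sub>F w in nhds \<tau>. (pfun F (cos w) - of_real m) / of_real r = g w"
      by eventually_elim (simp add: g_def P_pfun)
    ultimately show ?thesis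
      using DERIV_cong_ev[OF refl ev refl] by blast
  qed
  have hol_g: "g holomorphic_on {z. 0 < Im z \<and> Im z < \<delta>}"
    unfolding holomorphic_on_def
    using der_g field_differentiable_def field_differentiable_at_within by blast
  have unit: "cmod (g (complex_of_real x)) = 1" for x
    using Preal[of x] r0(1) by (auto simp: g_def circle norm_divide)
  \<comment> \<open>The red slot already fills the red boundary and \<open>F\<close> is injective,
    so no point above the axis goes to the circle; the weak inequality \<open>outside\<close>
    becomes strict.\<close>
  have outer: "cmod (g \<tau>) > 1" if \<tau>: "0 < Im \<tau>" "Im \<tau> < \<delta>" for \<tau>
  proof -
    obtain w where w: "P \<tau> = Some w" using \<delta>(2)[of \<tau>] \<tau> by (auto simp: good_def)
    have pt: "slot_pt \<tau> \<in> points (pants_R a)" using slot_pt_in_points[OF a] \<tau> by simp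
    then have Fpt: "F (slot_pt \<tau>) \<in> points G" using surj by blast
    have "r\<^sup>2 \<le> (cmod (w - of_real m))\<^sup>2"
      using outside[OF Fpt] w r0 by (simp add: P_def)
    then have "r \<le> cmod (w - of_real m)" by (rule power2_le_imp_le) simp
    moreover have "w \<notin> circle_C lam"
    proof
      assume "w \<in> circle_C lam"
      then have "F (slot_pt \<tau>) \<in> F ` over_slot a (-1) 1"
        using w Fpt by (simp add: red red_iff P_def)
      then have "slot_pt \<tau> \<in> over_slot a (-1) 1"
        using inj_on_image_mem_iff[OF inj pt over] by simp
      then show False using slot_pt_notin_over_slot \<tau>(1) by blast
    qed
    ultimately have "r < cmod (w - of_real m)" by (simp add: circle)
    then show ?thesis using w r0(1) by (simp add: g_def norm_divide)
  qed
  have per: "g (complex_of_real (x + 2 * pi)) = g (complex_of_real x)" for x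
    using Pper[of "complex_of_real x" 1] by (simp add: g_def)
  obtain \<psi> \<psi>' D where \<psi>: "\<And>x. (\<psi> has_real_derivative \<psi>' x) (at x)" "continuous_on UNIV \<psi>'"
    "\<And>x. \<psi>' x > 0" "\<And>x. g (complex_of_real x) = cis (- \<psi> x)"
    "\<And>x. ((\<lambda>z. deriv g z) \<longlongrightarrow> - \<i> * complex_of_real (\<psi>' x) * cis (- \<psi> x))
        (at (complex_of_real x) within {z. 0 < Im z})"
    "\<psi> pi - \<psi> (- pi) = 2 * pi * of_int D"
    using boundary_argument[OF \<delta>(1) cont_g hol_g unit outer per] by metis
  have Px: "P (complex_of_real x) = Some (of_real m + of_real r * cis (- \<psi> x))" for x
    using P_g[OF goodreal] by (simp add: \<psi>(4))
  have mono: "\<psi> x < \<psi> y" if "x < y" for x y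
    by (rule DERIV_pos_imp_increasing[OF that]) (use \<psi>(1,3) in blast)
  have lim: "((\<lambda>t. deriv (pfun F) (Complex (cos x) (if x < 0 then t else - t))) \<longlongrightarrow>
        \<i> * of_real (r * \<psi>' x / sin x) * cis (- \<psi> x)) (at_right 0)"
    and diff: "\<forall>\<^sub>F t in at_right 0. pfun F field_differentiable at (Complex (cos x) (if x < 0 then t else - t))"
    if x: "-pi < x" "x < pi" "x \<noteq> 0" for x
  proof -
    \<comment> \<open>The normal to the bank is lifted to the strip, where \<open>deriv g\<close>
      has boundary values; multiplying by \<open>r\<close> and dividing by the derivative
      \<open>- sin\<close> of the cosine recovers the derivative of \<open>p\<close>.\<close>
    obtain \<tau> where \<tau>: "\<And>t. cos (\<tau> t) = Complex (cos x) (if x < 0 then t else - t)"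
      "\<And>t. t > 0 \<Longrightarrow> Im (\<tau> t) > 0"
      "filterlim \<tau> (at (complex_of_real x) within {z. Im z > 0}) (at_right 0)"
      using arccos_normal[OF x] by blast
    have "0 < \<bar>x\<bar>" "\<bar>x\<bar> < pi" using x by auto
    then have "sin \<bar>x\<bar> > 0" by (intro sin_gt_zero)
    then have sx: "sin x \<noteq> 0" by (auto simp: abs_if split: if_splits)
    have \<tau>x: "(\<tau> \<longlongrightarrow> complex_of_real x) (at_right 0)"
      using \<tau>(3) by (simp add: filterlim_at)
    have below: "\<forall>\<^sub>F t in at_right 0. \<tau> t \<in> {z. Im z < \<delta>}"
      using \<delta>(1) by (intro topological_tendstoD[OF \<tau>x open_halfspace_Im_lt]) auto
    then show "\<forall>\<^sub>F t in at_right 0. pfun F field_differentiable at (Complex (cos x) (if x < 0 then t else - t))"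
      using eventually_at_right_less[of "0::real"]
    proof eventually_elim
      case (elim t)
      then show ?case using diff_pfun[of "\<tau> t"] \<tau>(1,2) by simp
    qed
    have s\<tau>: "((\<lambda>t. sin (\<tau> t)) \<longlongrightarrow> of_real (sin x)) (at_right 0)"
      using tendsto_sin[OF \<tau>x] by (simp add: sin_of_real)
    have "((\<lambda>t. deriv g (\<tau> t)) \<longlongrightarrow> - \<i> * complex_of_real (\<psi>' x) * cis (- \<psi> x)) (at_right 0)"
      by (rule filterlim_compose[OF \<psi>(5) \<tau>(3)])
    then have l1: "((\<lambda>t. - of_real r * deriv g (\<tau> t) / sin (\<tau> t)) \<longlongrightarrow>
        - of_real r * (- \<i> * complex_of_real (\<psi>' x) * cis (- \<psi> x)) / of_real (sin x)) (at_right 0)"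
      using sx by (intro tendsto_intros s\<tau>) auto
    have l2: "- of_real r * (- \<i> * complex_of_real (\<psi>' x) * cis (- \<psi> x)) / of_real (sin x) =
        \<i> * of_real (r * \<psi>' x / sin x) * cis (- \<psi> x)" by simp
    have ev: "\<forall>\<^sub>F t in at_right 0. - of_real r * deriv g (\<tau> t) / sin (\<tau> t) =
        deriv (pfun F) (Complex (cos x) (if x < 0 then t else - t))"
    proof -
      have "\<forall>\<^sub>F t in at_right 0. sin (\<tau> t) \<noteq> 0"
        using s\<tau> sx by (intro tendsto_imp_eventually_ne) auto
      then show ?thesis
        using below eventually_at_right_less[of "0::real"]
      proof eventually_elim
        case (elim t)
        then have "deriv g (\<tau> t) = deriv (pfun F) (cos (\<tau> t)) * (- sin (\<tau> t)) / of_real r"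
          using \<tau>(2) by (intro DERIV_imp_deriv der_g) auto
        then show ?case using elim r0(1) \<tau>(1) by simp
      qed
    qed
    show "((\<lambda>t. deriv (pfun F) (Complex (cos x) (if x < 0 then t else - t))) \<longlongrightarrow>
        \<i> * of_real (r * \<psi>' x / sin x) * cis (- \<psi> x)) (at_right 0)"
      by (rule Lim_transform_eventually[OF l1[unfolded l2] ev])
  qed
  have "2 * pi * of_int D > 0" using mono[of "-pi" pi] \<psi>(6) by simp
  then have "D > 0" by (simp add: zero_less_mult_iff)
  \<comment> \<open>\<open>w\<close> is the value of \<open>p\<close> at the end \<open>-1\<close>
    of the slot, and \<open>A\<close> collects the parameters of one full period at which
    \<open>p\<close> takes this value.\<close>
  define w where "w = complex_of_real m + of_real r * cis (- \<psi> (- pi))"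
  define A where "A = {x \<in> {-pi<..pi}. \<exists>k::int. \<psi> x - \<psi> (-pi) = 2 * pi * of_int k}"
  have "card A = nat D"
    unfolding A_def
  proof (rule card_multiples_2pi)
    show "continuous_on {- pi..pi} (\<lambda>x. \<psi> x - \<psi> (- pi))"
      by (intro continuous_intros DERIV_continuous_on[where D=\<psi>']) (rule has_field_derivative_at_within[OF \<psi>(1)])
    show "strict_mono_on {- pi..pi} (\<lambda>x. \<psi> x - \<psi> (- pi))"
      using mono by (auto simp: strict_mono_on_def)
  qed (use \<psi>(6) \<open>D > 0\<close> in auto)
  moreover have "bij_betw (\<lambda>x. F (slot_pt (complex_of_real x))) A {q \<in> points G. proj q = Some w}"
    unfolding bij_betw_def
  proof
    have "inj_on (F \<circ> (\<lambda>x. slot_pt (complex_of_real x))) {-pi<..pi}"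
      using bij_betw_slot_pt[OF a] inj over
      by (intro comp_inj_on) (auto simp: bij_betw_def intro: inj_on_subset)
    then show "inj_on (\<lambda>x. F (slot_pt (complex_of_real x))) A"
      unfolding o_def by (rule inj_on_subset) (auto simp: A_def)
    have A_iff: "x \<in> A \<longleftrightarrow> P (complex_of_real x) = Some w" if "x \<in> {-pi<..pi}" for x
    proof -
      have "P (complex_of_real x) = Some w \<longleftrightarrow> cis (- \<psi> (-pi)) = cis (- \<psi> x)"
        using r0(1) by (auto simp: Px w_def)
      then show ?thesis using that by (auto simp: cis_eq_cis_iff A_def)
    qed
    show "(\<lambda>x. F (slot_pt (complex_of_real x))) ` A = {q \<in> points G. proj q = Some w}"
    proof (intro equalityI subsetI)
      fix q assume "q \<in> (\<lambda>x. F (slot_pt (complex_of_real x))) ` A"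
      then obtain x where x: "x \<in> A" "q = F (slot_pt (complex_of_real x))" by blast
      then show "q \<in> {q \<in> points G. proj q = Some w}"
        using A_iff[of x] imageI[OF slot_pt_in_points[OF a, of "complex_of_real x"], of F]
        unfolding surj by (simp add: P_def A_def)
    next
      fix q assume q: "q \<in> {q \<in> points G. proj q = Some w}"
      have "w \<in> circle_C lam" using r0(1) by (simp add: circle w_def norm_mult)
      then have "q \<in> F ` over_slot a (-1) 1" using q unfolding red red_iff by blast
      then have "q \<in> F ` (\<lambda>x. slot_pt (complex_of_real x)) ` {-pi<..pi}"
        by (simp only: bij_betw_imp_surj_on[OF bij_betw_slot_pt[OF a]])
      then obtain x where x: "x \<in> {-pi<..pi}" "q = F (slot_pt (complex_of_real x))"
        by blast
      then have "x \<in> A" using A_iff[of x] q by (simp add: P_def)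
      then show "q \<in> (\<lambda>x. F (slot_pt (complex_of_real x))) ` A" using x by blast
    qed
  qed
  ultimately have "card {q \<in> points G. proj q = Some w} = nat D"
    by (simp add: bij_betw_same_card)
  moreover have "w \<in> circle_C lam" using r0(1) by (simp add: circle w_def norm_mult)
  ultimately have "d = nat D" using fibre by simp
  then have D: "\<psi> pi - \<psi> (- pi) = 2 * pi * real d" using \<psi>(6) \<open>D > 0\<close> by simp
  show ?thesis
    by (rule that[of \<psi> \<psi>']) (fact \<psi>(1-3) Px[unfolded P_def] lim diff D)+
qed

section \<open>Zeros of the eigenfunction\<close>

text \<open>The difference \<open>\<psi> t - \<psi> (- t)\<close> increases from \<open>0\<close> to
  \<open>2 * pi * d\<close>. This gives \<open>d\<close> coincidences with \<open>t > 0\<close>, the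
  last one at \<open>pi\<close>, and \<open>t = 0\<close> is one more.\<close>

lemma card_boundary_coincidences:
  fixes \<psi> :: "real \<Rightarrow> real" and d :: nat
  assumes cont: "continuous_on UNIV \<psi>" and mono: "strict_mono \<psi>"
    and d: "\<psi> pi - \<psi> (- pi) = 2 * pi * real d"
  shows "card {t \<in> {0..pi}. cis (- \<psi> t) = cis (- \<psi> (- t))} = d + 1"
proof -
  define A where "A = {t \<in> {0<..pi}. \<exists>k::int. \<psi> t - \<psi> (- t) = 2 * pi * of_int k}"
  have card_A: "card A = d"
    unfolding A_def
  proof (rule card_multiples_2pi)
    show "continuous_on {0..pi} (\<lambda>t. \<psi> t - \<psi> (- t))"
      by (intro continuous_intros continuous_on_compose2[OF cont] continuous_on_subset[OF cont]) auto
    show "strict_mono_on {0..pi} (\<lambda>t. \<psi> t - \<psi> (- t))"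
    proof (rule strict_mono_onI)
      fix x y :: real assume "x < y"
      then show "\<psi> x - \<psi> (- x) < \<psi> y - \<psi> (- y)"
        using strict_monoD[OF mono, of x y] strict_monoD[OF mono, of "-y" "-x"] by simp
    qed
  qed (use d in auto)
  have "\<psi> (- pi) < \<psi> pi" by (rule strict_monoD[OF mono]) simp
  then have "d > 0" using d by (auto simp: zero_less_mult_iff intro!: Nat.gr0I)
  \<comment> \<open>An infinite set has cardinality \<open>0\<close>, so positivity of
    \<open>d\<close> yields finiteness; then \<open>insert 0 A\<close> has one element more than
    \<open>A\<close>.\<close>
  then have "finite A" using card_A card.infinite by fastforce
  have "{t \<in> {0..pi}. cis (- \<psi> t) = cis (- \<psi> (- t))} = insert 0 A"
  proof (intro equalityI subsetI)
    fix t assume "t \<in> {t \<in> {0..pi}. cis (- \<psi> t) = cis (- \<psi> (- t))}"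
    then have t: "t \<in> {0..pi}" "cis (- \<psi> (- t)) = cis (- \<psi> t)" by auto
    then obtain k :: int where "- \<psi> (- t) - - \<psi> t = 2 * pi * of_int k"
      unfolding cis_eq_cis_iff by blast
    then have "\<psi> t - \<psi> (- t) = 2 * pi * of_int k" by simp
    then show "t \<in> insert 0 A" using t(1) by (cases "t = 0") (auto simp: A_def)
  next
    fix t assume t: "t \<in> insert 0 A"
    show "t \<in> {t \<in> {0..pi}. cis (- \<psi> t) = cis (- \<psi> (- t))}"
    proof (cases "t = 0")
      case False
      then obtain k :: int where k: "t \<in> {0<..pi}" "\<psi> t - \<psi> (- t) = 2 * pi * of_int k"
        using t by (auto simp: A_def)
      then have "- \<psi> (- t) - - \<psi> t = 2 * pi * of_int k" by simp
      then have "cis (- \<psi> (- t)) = cis (- \<psi> t)" unfolding cis_eq_cis_iff by blast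
      then show ?thesis using k(1) by simp
    qed simp
  qed
  then show ?thesis
    using card_A \<open>finite A\<close> by (simp add: A_def)
qed

text \<open>Rolle's theorem excludes equal values. An inner point with value \<open>1\<close> or
  \<open>-1\<close> would be a local extremum of a map into \<open>[-1, 1]\<close>, where the
  derivative vanishes.\<close>

lemma bij_betw_if_deriv_nonzero:
  fixes f :: "real \<Rightarrow> real"
  assumes "\<And>x. x \<in> {-1..1} \<Longrightarrow> (f has_real_derivative f' x) (at x)"
    and "\<And>x. x \<in> {-1..1} \<Longrightarrow> f' x \<noteq> 0"
    and img: "f ` {-1..1} = {-1..1}"
  shows "bij_betw f {-1..1} {-1..1}" "\<And>x. x \<in> {-1<..<1} \<Longrightarrow> f x \<in> {-1<..<1}"
proof -
  have "f x \<noteq> f y" if xy: "x \<in> {-1..1}" "y \<in> {-1..1}" "x < y" for x y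
  proof
    assume "f x = f y"
    moreover have "continuous_on {x..y} f"
      by (intro continuous_at_imp_continuous_on ballI DERIV_isCont[OF assms(1)]) (use xy in auto)
    moreover have "f differentiable (at z)" if "x < z" "z < y" for z
      using that xy assms(1)[of z] by (auto simp: real_differentiable_def)
    ultimately obtain z where z: "x < z" "z < y" "(f has_real_derivative 0) (at z)"
      using Rolle[of x y f] xy(3) by blast
    then have "z \<in> {-1..1}" using xy by auto
    then show False using assms(1,2) DERIV_unique z(3) by blast
  qed
  then have "inj_on f {-1..1}" by (intro linorder_inj_onI) auto
  then show "bij_betw f {-1..1} {-1..1}" using img by (simp add: bij_betw_def)
  fix x :: real assume x: "x \<in> {-1<..<1}"
  then have fx: "(f has_real_derivative f' x) (at x)" "f' x \<noteq> 0" using assms(1,2) by auto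
  define e where "e = min (1 - x) (x + 1)"
  have e: "e > 0" using x by (auto simp: e_def)
  have fy: "f y \<in> {-1..1}" if "\<bar>x - y\<bar> < e" for y
  proof -
    have "y \<in> {-1..1}" using that by (auto simp: e_def)
    then show ?thesis using img by blast
  qed
  have "f x \<noteq> 1" using DERIV_local_max[OF fx(1) e] fy fx(2) by fastforce
  moreover have "f x \<noteq> -1" using DERIV_local_min[OF fx(1) e] fy fx(2) by fastforce
  moreover have "f x \<in> {-1..1}" using e fy[of x] by simp
  ultimately show "f x \<in> {-1<..<1}" by auto
qed

lemma slots_apart_if_standing:
  "standing_assumptions P Q a b c \<Longrightarrow> slots_apart a"
  by (auto simp: standing_assumptions_def slots_apart_def)

text \<open>A critical boundary point requires a limit within a half-plane, which is tested here
  along the normal. At an inner point of the slot the inverse local parameter is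
  \<open>y + t\<close> or \<open>y - t\<close>, so the limit along the normal is \<open>L\<close> up
  to sign and cannot be \<open>0\<close>.\<close>

lemma not_critical_on_bank:
  assumes a: "slots_apart a" and y: "y \<in> {-1<..<1}"
    and finite: "proj (F ((), d, Some (complex_of_real y))) = Some c"
    and lim: "((\<lambda>t. deriv (pfun F) (Complex y (if d then t else - t))) \<longlongrightarrow> L) (at_right 0)" "L \<noteq> 0"
    and diff: "\<forall>\<^sub>F t in at_right 0. pfun F field_differentiable at (Complex y (if d then t else - t))"
  shows "((), d, Some (complex_of_real y)) \<notin> critical_points a F"
proof
  assume crit: "((), d, Some (complex_of_real y)) \<in> critical_points a F"
  define \<sigma> :: complex where "\<sigma> = (if d then 1 else -1)"
  have "Some (complex_of_real y) \<in> slot_points a"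
    using y by (auto simp: slot_points_def slots_def)
  then have "(deriv (\<lambda>t. chart (proj (F ((), d, Some (complex_of_real y))))
                     (proj (F ((), True, Some (boundary_param a d y t))))) \<longlongrightarrow> 0)
          (at 0 within {t. Im t > 0})"
    using crit by (auto simp: critical_points_def)
  moreover have "boundary_param a d y t = complex_of_real y + \<sigma> * t" for t
  proof -
    have "y \<notin> {-1, 1, a 1, a 2, a 3, a 4}"
      using y a by (auto simp: slots_apart_def)
    then show ?thesis by (auto simp: boundary_param_def slots_def \<sigma>_def)
  qed
  ultimately have 0: "(deriv (\<lambda>t. pfun F (complex_of_real y + \<sigma> * t) - c) \<longlongrightarrow> 0) (at 0 within {t. Im t > 0})"
    by (simp add: finite chart_def pfun_def)
  have "filterlim (\<lambda>t. \<i> * complex_of_real t) (at 0 within {t. Im t > 0}) (at_right 0)"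
    unfolding filterlim_at
  proof
    show "\<forall>\<^sub>F t in at_right 0. \<i> * complex_of_real t \<in> {t. 0 < Im t} \<and> \<i> * complex_of_real t \<noteq> 0"
      using eventually_at_right_less[of "0::real"] by eventually_elim auto
    show "((\<lambda>t. \<i> * complex_of_real t) \<longlongrightarrow> 0) (at_right 0)"
      by (auto intro!: tendsto_eq_intros)
  qed
  from filterlim_compose[OF 0 this]
  have "((\<lambda>t. deriv (\<lambda>t. pfun F (complex_of_real y + \<sigma> * t) - c) (\<i> * complex_of_real t)) \<longlongrightarrow> 0) (at_right 0)" .
  moreover have "\<forall>\<^sub>F t in at_right 0. deriv (\<lambda>t. pfun F (complex_of_real y + \<sigma> * t) - c) (\<i> * complex_of_real t) =
      \<sigma> * deriv (pfun F) (Complex y (if d then t else - t))"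
    using diff
  proof eventually_elim
    case (elim t)
    have eq: "complex_of_real y + \<sigma> * (\<i> * of_real t) = Complex y (if d then t else - t)"
      by (simp add: \<sigma>_def complex_eq_iff)
    have f: "(pfun F has_field_derivative deriv (pfun F) (Complex y (if d then t else - t)))
        (at (complex_of_real y + \<sigma> * (\<i> * of_real t)))"
      unfolding eq using elim by (simp add: field_differentiable_derivI)
    have "((\<lambda>t. complex_of_real y + \<sigma> * t) has_field_derivative \<sigma>) (at (\<i> * of_real t))"
      by (auto intro!: derivative_eq_intros)
    from DERIV_chain2[where g="\<lambda>t. complex_of_real y + \<sigma> * t", OF f this]
    have "((\<lambda>t. pfun F (complex_of_real y + \<sigma> * t) - c) has_field_derivative
        deriv (pfun F) (Complex y (if d then t else - t)) * \<sigma> - 0) (at (\<i> * of_real t))"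
      by (intro DERIV_diff DERIV_const)
    then show ?case by (simp add: DERIV_imp_deriv mult.commute)
  qed
  ultimately have "((\<lambda>t. \<sigma> * deriv (pfun F) (Complex y (if d then t else - t))) \<longlongrightarrow> 0) (at_right 0)"
    by (rule Lim_transform_eventually)
  moreover have "((\<lambda>t. \<sigma> * deriv (pfun F) (Complex y (if d then t else - t))) \<longlongrightarrow> \<sigma> * L) (at_right 0)"
    by (intro tendsto_intros lim)
  ultimately have "\<sigma> * L = 0"
    using tendsto_unique[OF trivial_limit_at_right_real] by blast
  then show False using lim(2) by (auto simp: \<sigma>_def split: if_splits)
qed

text \<open>The modulus of \<open>u\<close> does not depend on the branches \<open>S\<close> and
  \<open>w\<close>, so the zeros are read off from \<open>(cmod (u x))\<^sup>2\<close>. Inside the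
  segment only the difference of the two boundary values can vanish, and
  \<open>arccos \<circ> f\<close> carries the zeros to the coincidences of
  \<open>\<psi>\<close>.\<close>

lemma card_zeros_of_eigenfunction:
  fixes f f' :: "real \<Rightarrow> real"
  assumes a: "slots_apart a"
    and f: "\<And>x. x \<in> {-1..1} \<Longrightarrow> (f has_real_derivative f' x) (at x)"
      "\<And>x. x \<in> {-1..1} \<Longrightarrow> f' x \<noteq> 0" "f ` {-1..1} = {-1..1}"
    and \<psi>: "\<And>x. (\<psi> has_real_derivative \<psi>' x) (at x)" "continuous_on UNIV \<psi>'" "\<And>x. \<psi>' x > 0"
    and P: "\<And>x. proj (F (slot_pt (complex_of_real x))) = Some (of_real m + of_real r * cis (- \<psi> x))"
    and r: "r > 0"
    and dp: "\<And>x. -pi < x \<Longrightarrow> x < pi \<Longrightarrow> x \<noteq> 0 \<Longrightarrow>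
      ((\<lambda>t. deriv (pfun F) (Complex (cos x) (if x < 0 then t else - t))) \<longlongrightarrow>
        \<i> * of_real (r * \<psi>' x / sin x) * cis (- \<psi> x)) (at_right 0)"
    and D: "\<psi> pi - \<psi> (- pi) = 2 * pi * real d"
    and y: "\<And>y. y \<in> {-1<..<1} \<Longrightarrow> y1 \<noteq> complex_of_real y \<and> y2 \<noteq> complex_of_real y"
    and u: "eigenfunction_formula a f F y1 y2 u"
  shows "card {x \<in> {-1..1}. u x = 0} = d + 1"
proof -
  have bij: "bij_betw f {-1..1} {-1..1}" and int: "\<And>x. x \<in> {-1<..<1} \<Longrightarrow> f x \<in> {-1<..<1}"
    using bij_betw_if_deriv_nonzero[OF f] by blast+
  define N where "N = (\<lambda>t. cmod (cis (- \<psi> (- t)) - cis (- \<psi> t)))"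
  define W where "W = (\<lambda>y. \<Prod>s=1..4. y - a s)"
  \<comment> \<open>This will be the squared modulus of \<open>u\<close> at \<open>y = f x\<close>.
    The factors \<open>1 / sin\<close> of the two boundary derivatives cancel the factor
    \<open>1 - y\<^sup>2\<close> of the squared modulus of \<open>w\<close>, and the powers of
    \<open>r\<close> cancel as well, so \<open>E\<close> has no singularity at the ends.\<close>
  define E where "E = (\<lambda>y. cmod (of_real y - y1) * cmod (of_real y - y2) * (N (arccos y))\<^sup>2 /
      (\<psi>' (arccos y) * \<psi>' (- arccos y) * \<bar>W y\<bar>))"
  have W: "W y \<noteq> 0" if "y \<in> {-1..1}" for y
  proof -
    have "a s \<notin> {-1..1}" if "s \<in> {1..4}" for s
    proof -
      have "{1..4} = {1, 2, 3, 4::nat}" by auto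
      then have "s = 1 \<or> s = 2 \<or> s = 3 \<or> s = 4" using that by blast
      then have "a s \<in> {a 1..a 2} \<union> {a 3..a 4}" using a by (auto simp: slots_apart_def)
      then show ?thesis using a unfolding slots_apart_def by blast
    qed
    then show ?thesis using that by (auto simp: W_def)
  qed
  have cont\<psi>: "continuous_on UNIV \<psi>"
    by (intro continuous_at_imp_continuous_on ballI DERIV_isCont[OF \<psi>(1)])
  have cont_comp: "continuous_on S (\<lambda>x. h (g x))"
    if "continuous_on UNIV h" "continuous_on S g" for h :: "real \<Rightarrow> real" and g S
    by (rule continuous_on_compose2[OF that]) simp
  have E_cont: "continuous_on {-1..1} E"
    unfolding E_def N_def W_def
    by (intro continuous_intros continuous_on_cis cont_comp[OF cont\<psi>] cont_comp[OF \<psi>(2)] continuous_on_arccos')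
      (use W \<psi>(3) in \<open>auto simp: W_def less_imp_neq[symmetric]\<close>)
  have arc: "arccos y \<in> {0<..<pi}" "cos (arccos y) = y" "sin (arccos y) > 0"
    "(sin (arccos y))\<^sup>2 = 1 - y\<^sup>2" if "y \<in> {-1<..<1}" for y
  proof -
    show "arccos y \<in> {0<..<pi}" using arccos_lt_bounded[of y] that by auto
    then show "sin (arccos y) > 0" by (intro sin_gt_zero) auto
    show "cos (arccos y) = y" using that by simp
    then show "(sin (arccos y))\<^sup>2 = 1 - y\<^sup>2" by (simp add: sin_squared_eq)
  qed
  obtain S w where u_cont: "continuous_on {-1..1} u" and Sw: "\<And>x. x \<in> {-1<..<1} \<Longrightarrow>
     (S x)\<^sup>2 = (complex_of_real (f x) - y1) * (complex_of_real (f x) - y2) /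
                     (dp_bank F True (f x) * dp_bank F False (f x)) \<and>
          (w x)\<^sup>2 = complex_of_real (w_squared a (f x)) \<and>
          u x = S x * ((p_bank F True (f x) - p_bank F False (f x)) / w x)"
    using u unfolding eigenfunction_formula_def Let_def by blast
  have uE: "(cmod (u x))\<^sup>2 = E (f x)" if x: "x \<in> {-1<..<1}" for x
  proof -
    define y where "y = f x"
    define t where "t = arccos y"
    have yI: "y \<in> {-1<..<1}" using int[OF x] by (simp add: y_def)
    note t = arc[OF yI, folded t_def]
    \<comment> \<open>The sine is positive at \<open>t\<close> and negative at \<open>- t\<close>,
      so \<open>t\<close> belongs to the lower bank, with flag \<open>False\<close>, and
      \<open>- t\<close> to the upper one.\<close>
    have "slot_pt (complex_of_real t) = ((), False, Some (complex_of_real y))"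
      "slot_pt (complex_of_real (- t)) = ((), True, Some (complex_of_real y))"
      using t unfolding slot_pt_of_real by simp_all
    then have p: "p_bank F False y = of_real m + of_real r * cis (- \<psi> t)"
      "p_bank F True y = of_real m + of_real r * cis (- \<psi> (- t))"
      using P[of t] P[of "-t"] by (simp_all only: p_bank_def option.sel)
    have "((\<lambda>s. deriv (pfun F) (Complex y (- s))) \<longlongrightarrow>
        \<i> * of_real (r * \<psi>' t / sin t) * cis (- \<psi> t)) (at_right 0)"
      using dp[of t] t by simp
    then have dF: "dp_bank F False y = \<i> * of_real (r * \<psi>' t / sin t) * cis (- \<psi> t)"
      by (simp add: dp_bank_def tendsto_Lim)
    have "((\<lambda>s. deriv (pfun F) (Complex y s)) \<longlongrightarrow>
        \<i> * of_real (r * \<psi>' (-t) / sin (-t)) * cis (- \<psi> (-t))) (at_right 0)"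
      using dp[of "-t"] t by simp
    then have dT: "dp_bank F True y = \<i> * of_real (r * \<psi>' (-t) / sin (-t)) * cis (- \<psi> (-t))"
      by (simp add: dp_bank_def tendsto_Lim)
    have norms: "cmod (dp_bank F False y) = r * \<psi>' t / sin t"
      "cmod (dp_bank F True y) = r * \<psi>' (-t) / sin t"
      unfolding dF dT using r t(3) \<psi>(3)[of t] \<psi>(3)[of "-t"]
      by (simp_all only: norm_mult norm_ii norm_cis norm_of_real) simp_all
    have "(cmod (S x))\<^sup>2 = cmod (of_real y - y1) * cmod (of_real y - y2) /
        ((r * \<psi>' (-t) / sin t) * (r * \<psi>' t / sin t))"
      using Sw[OF x] norms by (simp add: y_def norm_mult norm_divide flip: norm_power)
    moreover have "(cmod (w x))\<^sup>2 = (sin t)\<^sup>2 * \<bar>W y\<bar>"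
    proof -
      have "(cmod (w x))\<^sup>2 = \<bar>w_squared a y\<bar>"
        using Sw[OF x] by (simp add: y_def flip: norm_power)
      also have "\<dots> = \<bar>- ((sin t)\<^sup>2)\<bar> * \<bar>W y\<bar>"
        by (simp only: t(4) w_squared_def abs_mult W_def) simp
      finally show ?thesis by simp
    qed
    moreover have "cmod (p_bank F True y - p_bank F False y) = r * N t"
    proof -
      have "p_bank F True y - p_bank F False y = of_real r * (cis (- \<psi> (- t)) - cis (- \<psi> t))"
        by (simp add: p algebra_simps)
      then show ?thesis using r by (simp add: norm_mult N_def)
    qed
    moreover have "(cmod (u x))\<^sup>2 = (cmod (S x))\<^sup>2 * (cmod (p_bank F True y - p_bank F False y))\<^sup>2 / (cmod (w x))\<^sup>2"
      using Sw[OF x] by (simp add: y_def norm_mult norm_divide power_mult_distrib power_divide)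
    ultimately have "(cmod (u x))\<^sup>2 = cmod (of_real y - y1) * cmod (of_real y - y2) /
        ((r * \<psi>' (-t) / sin t) * (r * \<psi>' t / sin t)) * (r * N t)\<^sup>2 / ((sin t)\<^sup>2 * \<bar>W y\<bar>)"
      by simp
    also have "\<dots> = E y"
      using r t(3) \<psi>(3)[of t] \<psi>(3)[of "-t"]
      by (simp add: E_def t_def[symmetric] power2_eq_square mult_ac)
    finally show ?thesis by (simp add: y_def)
  qed
  \<comment> \<open>The formula for \<open>u\<close> is imposed on the open interval; both sides are
    continuous, so the identity passes to the ends.\<close>
  have uE': "(cmod (u x))\<^sup>2 = E (f x)" if x: "x \<in> {-1..1}" for x
  proof -
    have f_cont: "continuous_on {-1..1} f"
      by (intro continuous_at_imp_continuous_on ballI DERIV_isCont[OF f(1)])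
    have cl: "closure {-1<..<1::real} = {-1..1}" by simp
    have "continuous_on {-1..1} (\<lambda>x. (cmod (u x))\<^sup>2 - E (f x))"
      by (intro continuous_intros u_cont continuous_on_compose2[OF E_cont f_cont]) (use f(3) in auto)
    from continuous_constant_on_closure[where S="{-1<..<1::real}", unfolded cl, OF this, of 0 x]
    have "(cmod (u x))\<^sup>2 - E (f x) = 0"
      using uE x by simp
    then show ?thesis by simp
  qed
  have u0: "u x = 0 \<longleftrightarrow> N (arccos (f x)) = 0" if x: "x \<in> {-1..1}" for x
  proof -
    have fx: "f x \<in> {-1..1}" using x f(3) by blast
    have "u x = 0 \<longleftrightarrow> E (f x) = 0" using uE'[OF x] by auto
    also have "\<dots> \<longleftrightarrow> N (arccos (f x)) = 0"
    proof (cases "f x \<in> {-1<..<1}")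
      case True
      then have "of_real (f x) - y1 \<noteq> 0" "of_real (f x) - y2 \<noteq> 0" using y[of "f x"] by auto
      then show ?thesis
        using W[OF fx] \<psi>(3)[of "arccos (f x)"] \<psi>(3)[of "- arccos (f x)"] by (auto simp: E_def)
    next
      \<comment> \<open>At an end both sides of the equivalence are true, because \<open>0\<close>
        and \<open>pi\<close> are coincidences. This also covers the case that \<open>y1\<close> or
        \<open>y2\<close> is an end of the slot.\<close>
      case False
      then consider "f x = 1" | "f x = -1" using fx by force
      then have "N (arccos (f x)) = 0"
      proof cases
        case 2
        have "- \<psi> (- pi) - - \<psi> pi = 2 * pi * of_int (int d)" using D by simp
        then have "cis (- \<psi> (- pi)) = cis (- \<psi> pi)" unfolding cis_eq_cis_iff by blast
        then show ?thesis by (simp add: 2 N_def)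
      qed (simp add: N_def)
      then show ?thesis by (simp add: E_def)
    qed
    finally show ?thesis .
  qed
  have "bij_betw (arccos \<circ> f) {-1..1} {0..pi}"
  proof (rule bij_betw_trans[OF bij])
    show "bij_betw arccos {-1..1} {0..pi}"
      by (rule bij_betw_byWitness[where f'=cos])
        (auto simp: arccos_cos arccos_lbound arccos_ubound)
  qed
  then have "bij_betw (arccos \<circ> f) {x \<in> {-1..1}. u x = 0}
      ((arccos \<circ> f) ` {x \<in> {-1..1}. u x = 0})"
    by (rule bij_betw_subset) auto
  moreover have "(arccos \<circ> f) ` {x \<in> {-1..1}. u x = 0} =
      {t \<in> {0..pi}. cis (- \<psi> t) = cis (- \<psi> (- t))}"
  proof -
    have "(arccos \<circ> f) ` {x \<in> {-1..1}. u x = 0} = (arccos \<circ> f) ` {x \<in> {-1..1}. N ((arccos \<circ> f) x) = 0}"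
      using u0 by (intro image_cong) auto
    also have "\<dots> = {t \<in> (arccos \<circ> f) ` {-1..1}. N t = 0}" by blast
    also have "(arccos \<circ> f) ` {-1..1} = {0..pi}"
      using \<open>bij_betw (arccos \<circ> f) {-1..1} {0..pi}\<close> by (rule bij_betw_imp_surj_on)
    finally show ?thesis by (auto simp: N_def)
  qed
  ultimately have "card {x \<in> {-1..1}. u x = 0} = card {t \<in> {0..pi}. cis (- \<psi> t) = cis (- \<psi> (- t))}"
    by (simp add: bij_betw_same_card)
  also have "\<dots> = d + 1"
  proof (rule card_boundary_coincidences[OF cont\<psi> _ D])
    show "strict_mono \<psi>"
      by (intro strict_monoI, erule DERIV_pos_imp_increasing) (use \<psi>(1,3) in blast)
  qed
  finally show ?thesis .
qed

theorem mainTheorem4: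
  fixes P Q :: "real poly" and R :: "real \<Rightarrow> real"
    and a :: "nat \<Rightarrow> real" and b c :: "nat \<Rightarrow> sphere"
    and lam h1 h2 :: real and s m1 m2 :: nat
    and g0 g1 g2 :: "complex \<times> complex"
    and F :: "unit point \<Rightarrow> sheet point"
    and y1 y2 :: complex and u :: "real \<Rightarrow> complex"
  assumes "standing_assumptions P Q a b c"
    and R: "\<And>x. R x = poly P x / poly Q x"
    and "1 < lam" "lam < 2" and "s \<in> {1, 2, 3}"
    and "admissible_cuts s lam h1 h2 g0 g1 g2"
    and "conformal_pants_map a s lam h1 h2 (pants s lam h1 h2 m1 m2 g0 g1 g2) F"
    and "s = 1 \<Longrightarrow> y1 = cnj y2 \<and> critical_points a F = {((), True, Some y1)}"
    and "s \<in> {2, 3} \<Longrightarrow> y1 \<in> \<real> \<and> y2 \<in> \<real> \<and>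
           (\<exists>q1 q2. q1 \<noteq> q2 \<and> critical_points a F = {q1, q2} \<and>
              proj q1 = Some y1 \<and> proj q2 = Some y2)"
    and "eigenfunction_formula a R F y1 y2 u"
    and "solves_equation lam R u"
  shows "(s \<in> {2, 3} \<longrightarrow> card {x \<in> {-1..1}. u x = 0} = m1 + m2 + 2) \<and>
         (s = 1 \<longrightarrow> card {x \<in> {-1..1}. u x = 0} = m1 + m2 + 3)"
proof -
  define G where "G = pants s lam h1 h2 m1 m2 g0 g1 g2"
  define m where "m = inverse (mu lam)"
  define r where "r = sqrt (m\<^sup>2 - 1)"
  define d where "d = (if s = 1 then m1 + m2 + 2 else m1 + m2 + 1)"
  have a: "slots_apart a" using assms(1) by (rule slots_apart_if_standing)
  have m1: "m > 1" using mu_bounds assms(3,4) by (simp add: m_def)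
  then have r0: "r > 0" using one_less_power[of m 2] by (simp add: r_def)
  have F: "conformal_pants_map a s lam h1 h2 G F" using assms(7) by (simp add: G_def)
  have outside: "(cmod (w - of_real m))\<^sup>2 \<ge> m\<^sup>2 - 1" if "q \<in> points G" "proj q = Some w" for q w
    using pants_region_outside_circle that unfolding G_def m_def by blast
  have fibre: "card {q \<in> points G. proj q = Some w} = d" if "w \<in> circle_C lam" for w
    unfolding G_def d_def by (rule card_fibre_pants[OF assms(3-6) that])
  obtain \<psi> \<psi>' where \<psi>: "\<And>x. (\<psi> has_real_derivative \<psi>' x) (at x)" "continuous_on UNIV \<psi>'"
      "\<And>x. \<psi>' x > 0"
    and P: "\<And>x. proj (F (slot_pt (complex_of_real x))) = Some (of_real m + of_real r * cis (- \<psi> x))"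
    and dp: "\<And>x. -pi < x \<Longrightarrow> x < pi \<Longrightarrow> x \<noteq> 0 \<Longrightarrow>
      ((\<lambda>t. deriv (pfun F) (Complex (cos x) (if x < 0 then t else - t))) \<longlongrightarrow>
        \<i> * of_real (r * \<psi>' x / sin x) * cis (- \<psi> x)) (at_right 0)"
    and diff: "\<And>x. -pi < x \<Longrightarrow> x < pi \<Longrightarrow> x \<noteq> 0 \<Longrightarrow>
      \<forall>\<^sub>F t in at_right 0. pfun F field_differentiable at (Complex (cos x) (if x < 0 then t else - t))"
    and D: "\<psi> pi - \<psi> (- pi) = 2 * pi * real d"
  proof (rule slot_boundary_values[where d=d, OF a F m_def m1 r_def], goal_cases)
    case (3 \<psi> \<psi>')
    show ?case by (rule that[of \<psi> \<psi>']) (fact 3)+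
  qed (use outside fibre in simp_all)
  \<comment> \<open>Positivity of \<open>\<psi>'\<close> excludes critical points over inner points
    of the slot, so the numerator under the root of \<open>u\<close> has no zero there. The
    parameter \<open>x\<close> is chosen on the bank with flag \<open>e\<close>.\<close>
  have no_crit: "((), e, Some (complex_of_real y)) \<notin> critical_points a F" if y: "y \<in> {-1<..<1}" for e y
  proof -
    define x where "x = (if e then - arccos y else arccos y)"
    have "0 < arccos y" "arccos y < pi" using arccos_lt_bounded[of y] y by auto
    then have x: "-pi < x" "x < pi" "x \<noteq> 0" "x < 0 \<longleftrightarrow> e" and s: "sin (arccos y) > 0"
      by (auto simp: x_def intro!: sin_gt_zero)
    have cx: "cos x = y" using y by (simp add: x_def)
    have "sin x \<noteq> 0" "sin x \<le> 0 \<longleftrightarrow> e" using s by (auto simp: x_def)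
    then have "proj (F ((), e, Some (complex_of_real y))) = Some (of_real m + of_real r * cis (- \<psi> x))"
      using P[of x] by (simp add: slot_pt_of_real cx)
    moreover have "\<i> * of_real (r * \<psi>' x / sin x) * cis (- \<psi> x) \<noteq> 0"
      using r0 \<psi>(3)[of x] \<open>sin x \<noteq> 0\<close> by simp
    ultimately show ?thesis
      using not_critical_on_bank[OF a y _ _ _ diff[OF x(1-3), unfolded cx x(4)]]
        dp[OF x(1-3), unfolded cx x(4)] by blast
  qed
  have y: "y1 \<noteq> complex_of_real y \<and> y2 \<noteq> complex_of_real y" if y: "y \<in> {-1<..<1}" for y
  proof (cases "s = 1")
    case True
    \<comment> \<open>A real \<open>y\<close> differs from \<open>y1\<close> exactly when it differs
      from the conjugate \<open>y2\<close>, so one critical point decides both.\<close>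
    with assms(8) have "((), True, Some y1) \<in> critical_points a F" "y1 = cnj y2" by auto
    then show ?thesis using no_crit[OF y, of True] by auto
  next
    case False
    then have "s \<in> {2, 3}" using assms(5) by blast
    from assms(9)[OF this] obtain q1 q2 where q: "q1 \<in> critical_points a F" "q2 \<in> critical_points a F"
      "proj q1 = Some y1" "proj q2 = Some y2" by blast
    \<comment> \<open>A critical point may carry either flag, which is why \<open>no_crit\<close>
      covers both banks.\<close>
    have "z \<noteq> complex_of_real y" if "q \<in> critical_points a F" "proj q = Some z" for q z
      using that no_crit[OF y] by (cases q) (auto simp: proj_def)
    then show ?thesis using q by blast
  qed
  have Rf: "R = (\<lambda>x. poly P x / poly Q x)" using R by blast
  have "(R has_real_derivative deriv R x) (at x)" if "x \<in> {-1..1}" for x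
  proof -
    have "poly Q x \<noteq> 0" using assms(1) that by (simp add: standing_assumptions_def)
    then have "\<exists>D. (R has_real_derivative D) (at x)"
      unfolding Rf using DERIV_divide[OF poly_DERIV poly_DERIV] by blast
    then show ?thesis using DERIV_imp_deriv by blast
  qed
  moreover have "deriv R x \<noteq> 0" if "x \<in> {-1..1}" for x
    using assms(1) that unfolding standing_assumptions_def Rf by blast
  moreover have "R ` {-1..1} = {-1..1}"
    using assms(1) unfolding standing_assumptions_def Rf by blast
  ultimately have "card {x \<in> {-1..1}. u x = 0} = d + 1"
    by (rule card_zeros_of_eigenfunction[OF a _ _ _ \<psi> P r0 dp D y assms(10)])
  then show ?thesis using assms(5) by (auto simp: d_def)
qed

end
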